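(* Let $G$ be a finite group and let $G_0=\bigcap_{\varepsilon}\mathrm{Ker}(\varepsilon)$, where $\varepsilon$ runs through the essential characters of $G$. Then: (i) $G_0$ is the subgroup of $G$ generated by the elements of order $2$ and by the squares. (ii) $G_0=G\cap U_G^0$, i.e. $G_0=G\cap U_G^0(k)$ for every field $k$ of characteristic $2$.
   Context: Let $C=\{1,c\}$ be a group of order $2$. An essential character of $G$ is a homomorphism $\varepsilon:G\to C$ such that $\varepsilon(g)=1$ for every $g\in G$ with $g^2=1$. For a field $k$ of characteristic $2$, the group algebra $k[G]$ carries its canonical involution, the $k$-linear anti-automorphism with $g^*=g^{-1}$ for $g\in G$. $U_G^{\mathrm{sch}}$ is the group scheme over $k$ whose points in a commutative $k$-algebra $k'$ are the $u\in k'[G]^\times$ with $uu^*=1$. $U_G$ is the kernel of the homomorphism $U_G^{\mathrm{sch}}\to\boldsymbol{\mu}_2$ induced by the augmentation $k[G]\to k$ (so its points are the unitary elements of augmentation $1$); it is a smooth group scheme. $U_G^0$ is its identity component. $G$ is viewed as a subgroup of $U_G(k)$. *)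

theory Defs
  imports
    "HOL-Analysis.Abstract_Topology_2"
    "HOL-Algebra.Algebra"
    "HOL-Library.Poly_Mapping"
begin

section \<open>Essential characters\<close>

definition essential_characters ::
    "('g, 'm) monoid_scheme \<Rightarrow> ('c, 'n) monoid_scheme \<Rightarrow> ('g \<Rightarrow> 'c) set" where
  "essential_characters G C =
     {\<epsilon> \<in> hom G C. \<forall>g\<in>carrier G. g \<otimes>\<^bsub>G\<^esub> g = \<one>\<^bsub>G\<^esub> \<longrightarrow> \<epsilon> g = \<one>\<^bsub>C\<^esub>}"

definition essential_kernel :: "('g, 'm) monoid_scheme \<Rightarrow> ('c, 'n) monoid_scheme \<Rightarrow> 'g set" where
  "essential_kernel G C = (\<Inter>\<epsilon>\<in>essential_characters G C. kernel G C \<epsilon>)"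


section \<open>Group algebras and unitary elements\<close>

text \<open>The elements of \<open>R[G]\<close> are functions on the ambient type that vanish outside of
  \<open>carrier G\<close>; \<open>u\<close> represents the sum of the \<open>u x \<cdot> x\<close>.\<close>

definition group_elem :: "'g \<Rightarrow> 'g \<Rightarrow> 'r::comm_ring_1" where
  "group_elem g = (\<lambda>x. if x = g then 1 else 0)"

definition group_algebra :: "('g, 'm) monoid_scheme \<Rightarrow> ('g \<Rightarrow> 'r::comm_ring_1) ring" where
  "group_algebra G =
     \<lparr>carrier = {u. \<forall>x. x \<notin> carrier G \<longrightarrow> u x = 0},
      monoid.mult = (\<lambda>u v x. if x \<in> carrier G then \<Sum>y\<in>carrier G. u y * v (inv\<^bsub>G\<^esub> y \<otimes>\<^bsub>G\<^esub> x) else 0),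
      monoid.one = group_elem \<one>\<^bsub>G\<^esub>,
      ring.zero = (\<lambda>x. 0),
      ring.add = (\<lambda>u v x. u x + v x)\<rparr>"

definition star :: "('g, 'm) monoid_scheme \<Rightarrow> ('g \<Rightarrow> 'r::comm_ring_1) \<Rightarrow> 'g \<Rightarrow> 'r" where
  "star G u = (\<lambda>x. if x \<in> carrier G then u (inv\<^bsub>G\<^esub> x) else 0)"

definition augmentation :: "('g, 'm) monoid_scheme \<Rightarrow> ('g \<Rightarrow> 'r::comm_ring_1) \<Rightarrow> 'r" where
  "augmentation G u = (\<Sum>x\<in>carrier G. u x)"

definition unitary_sch :: "('g, 'm) monoid_scheme \<Rightarrow> ('g \<Rightarrow> 'r::comm_ring_1) set" where
  "unitary_sch G =
     {u \<in> Units (group_algebra G). u \<otimes>\<^bsub>group_algebra G\<^esub> star G u = \<one>\<^bsub>group_algebra G\<^esub>}"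

definition unitary :: "('g, 'm) monoid_scheme \<Rightarrow> ('g \<Rightarrow> 'r::comm_ring_1) set" where
  "unitary G = {u \<in> unitary_sch G. augmentation G u = 1}"


section \<open>Prime spectra\<close>

definition Spec :: "('a, 'm) ring_scheme \<Rightarrow> 'a set set" where
  "Spec R = {\<pp>. primeideal \<pp> R}"

definition zariski :: "('a, 'm) ring_scheme \<Rightarrow> 'a set topology" where
  "zariski R = topology (\<lambda>U. \<exists>S\<subseteq>carrier R. U = {\<pp> \<in> Spec R. \<not> S \<subseteq> \<pp>})"


section \<open>The coordinate ring of the scheme of unitary elements\<close>

text \<open>The type \<open>('v \<Rightarrow>\<^sub>0 nat) \<Rightarrow>\<^sub>0 'k\<close> is the type of polynomials
  over \<open>'k\<close> in variables indexed by \<open>'v\<close>; a monomial is an exponent vector.\<close>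

definition poly_const :: "'k::comm_ring_1 \<Rightarrow> ('v \<Rightarrow>\<^sub>0 nat) \<Rightarrow>\<^sub>0 'k" where
  "poly_const a = Poly_Mapping.single 0 a"

definition poly_var :: "'v \<Rightarrow> ('v \<Rightarrow>\<^sub>0 nat) \<Rightarrow>\<^sub>0 'k::comm_ring_1" where
  "poly_var x = Poly_Mapping.single (Poly_Mapping.single x 1) 1"

definition poly_eval ::
    "('k \<Rightarrow> 'r) \<Rightarrow> ('v \<Rightarrow> 'r) \<Rightarrow> (('v \<Rightarrow>\<^sub>0 nat) \<Rightarrow>\<^sub>0 'k::comm_ring_1) \<Rightarrow> 'r::comm_ring_1" where
  "poly_eval \<phi> u p = (\<Sum>m\<in>Poly_Mapping.keys p. \<phi> (Poly_Mapping.lookup p m) *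
     (\<Prod>x\<in>Poly_Mapping.keys m. u x ^ Poly_Mapping.lookup m x))"

definition mpoly_ring :: "'v set \<Rightarrow> (('v \<Rightarrow>\<^sub>0 nat) \<Rightarrow>\<^sub>0 'k::comm_ring_1) ring" where
  "mpoly_ring V =
     \<lparr>carrier = {p. \<forall>m\<in>Poly_Mapping.keys p. Poly_Mapping.keys m \<subseteq> V},
      monoid.mult = (*), monoid.one = 1, ring.zero = 0, ring.add = (+)\<rparr>"

text \<open>The generic element of the group algebra, with coefficients in \<open>k[X\<^sub>g | g \<in> G]\<close>.\<close>

definition generic_elem ::
    "('g, 'm) monoid_scheme \<Rightarrow> 'g \<Rightarrow> ('g \<Rightarrow>\<^sub>0 nat) \<Rightarrow>\<^sub>0 'k::comm_ring_1" where
  "generic_elem G = (\<lambda>g. if g \<in> carrier G then poly_var g else 0)"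

text \<open>An element \<open>u\<close> is a unit with \<open>u u\<^sup>* = 1\<close> iff \<open>u u\<^sup>* = 1 = u\<^sup>* u\<close>. The coordinate ring is the
  quotient of the polynomial ring by these equations for the generic element, together with
  augmentation 1.\<close>

definition unitary_relations ::
    "('g, 'm) monoid_scheme \<Rightarrow> (('g \<Rightarrow>\<^sub>0 nat) \<Rightarrow>\<^sub>0 'k::comm_ring_1) set" where
  "unitary_relations G =
     (let \<xi> = generic_elem G in
       (\<lambda>g. (\<xi> \<otimes>\<^bsub>group_algebra G\<^esub> star G \<xi>) g - group_elem \<one>\<^bsub>G\<^esub> g) ` carrier G \<union>
       (\<lambda>g. (star G \<xi> \<otimes>\<^bsub>group_algebra G\<^esub> \<xi>) g - group_elem \<one>\<^bsub>G\<^esub> g) ` carrier G \<union>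
       {augmentation G \<xi> - 1})"

definition unitary_ideal ::
    "('g, 'm) monoid_scheme \<Rightarrow> (('g \<Rightarrow>\<^sub>0 nat) \<Rightarrow>\<^sub>0 'k::comm_ring_1) set" where
  "unitary_ideal G = genideal (mpoly_ring (carrier G)) (unitary_relations G)"

definition unitary_coord_ring ::
    "('g, 'm) monoid_scheme \<Rightarrow> (('g \<Rightarrow>\<^sub>0 nat) \<Rightarrow>\<^sub>0 'k::comm_ring_1) set ring" where
  "unitary_coord_ring G = mpoly_ring (carrier G) Quot unitary_ideal G"

text \<open>The class of a polynomial in the coordinate ring.\<close>

definition coord_class ::
    "('g, 'm) monoid_scheme \<Rightarrow> (('g \<Rightarrow>\<^sub>0 nat) \<Rightarrow>\<^sub>0 'k::comm_ring_1) \<Rightarrow> (('g \<Rightarrow>\<^sub>0 nat) \<Rightarrow>\<^sub>0 'k) set" where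
  "coord_class G p = unitary_ideal G +>\<^bsub>mpoly_ring (carrier G)\<^esub> p"

text \<open>The point of the spectrum underlying a rational point \<open>u\<close>: the kernel of evaluation at \<open>u\<close>.\<close>

definition unitary_point ::
    "('g, 'm) monoid_scheme \<Rightarrow> ('g \<Rightarrow> 'k::field) \<Rightarrow> (('g \<Rightarrow>\<^sub>0 nat) \<Rightarrow>\<^sub>0 'k) set set" where
  "unitary_point G u =
     coord_class G ` {p \<in> carrier (mpoly_ring (carrier G)). poly_eval (\<lambda>a. a) u p = 0}"

definition unitary_id_component ::
    "('g, 'm) monoid_scheme \<Rightarrow> (('g \<Rightarrow>\<^sub>0 nat) \<Rightarrow>\<^sub>0 'k::field) set set set" where
  "unitary_id_component G =
     connected_component_of_set (zariski (unitary_coord_ring G))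
       (unitary_point G \<one>\<^bsub>group_algebra G\<^esub>)"

text \<open>The identity component is open, so that a rational point belongs to it iff its underlying
  point of the spectrum does.\<close>

definition unitary_id_component_points :: "('g, 'm) monoid_scheme \<Rightarrow> ('g \<Rightarrow> 'k::field) set" where
  "unitary_id_component_points G = {u \<in> unitary G. unitary_point G u \<in> unitary_id_component G}"


section \<open>Basic facts\<close>

lemma openin_zariski:
  fixes R (structure) assumes "cring R"
  shows "openin (zariski R) U \<longleftrightarrow> (\<exists>S\<subseteq>carrier R. U = {\<pp> \<in> Spec R. \<not> S \<subseteq> \<pp>})"
proof -
  interpret cring R by fact
  have "istopology (\<lambda>U. \<exists>S\<subseteq>carrier R. U = {\<pp> \<in> Spec R. \<not> S \<subseteq> \<pp>})"
    unfolding istopology_def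
  proof (intro conjI allI impI)
    fix U V
    assume "\<exists>S\<subseteq>carrier R. U = {\<pp> \<in> Spec R. \<not> S \<subseteq> \<pp>}" "\<exists>S\<subseteq>carrier R. V = {\<pp> \<in> Spec R. \<not> S \<subseteq> \<pp>}"
    then obtain S T where ST: "S \<subseteq> carrier R" "U = {\<pp> \<in> Spec R. \<not> S \<subseteq> \<pp>}"
      "T \<subseteq> carrier R" "V = {\<pp> \<in> Spec R. \<not> T \<subseteq> \<pp>}" by blast
    define W where "W = {s \<otimes> t | s t. s \<in> S \<and> t \<in> T}"
    have "W \<subseteq> carrier R" using ST unfolding W_def by auto
    moreover have "(\<not> S \<subseteq> \<pp> \<and> \<not> T \<subseteq> \<pp>) \<longleftrightarrow> \<not> W \<subseteq> \<pp>" if "\<pp> \<in> Spec R" for \<pp>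
    proof -
      interpret primeideal \<pp> R using that by (simp add: Spec_def)
      show ?thesis
      proof
        assume "\<not> S \<subseteq> \<pp> \<and> \<not> T \<subseteq> \<pp>"
        then obtain s t where "s \<in> S" "s \<notin> \<pp>" "t \<in> T" "t \<notin> \<pp>" by blast
        moreover from this have "s \<otimes> t \<notin> \<pp>" using I_prime[of s t] ST by blast
        ultimately show "\<not> W \<subseteq> \<pp>" unfolding W_def by blast
      next
        assume "\<not> W \<subseteq> \<pp>"
        then obtain s t where "s \<in> S" "t \<in> T" "s \<otimes> t \<notin> \<pp>" unfolding W_def by blast
        then show "\<not> S \<subseteq> \<pp> \<and> \<not> T \<subseteq> \<pp>" using I_l_closed I_r_closed ST by blast
      qed
    qed
    ultimately show "\<exists>S\<subseteq>carrier R. U \<inter> V = {\<pp> \<in> Spec R. \<not> S \<subseteq> \<pp>}"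
      using ST by (intro exI[of _ W]) blast
  next
    fix \<K> assume K: "\<forall>U\<in>\<K>. \<exists>S\<subseteq>carrier R. U = {\<pp> \<in> Spec R. \<not> S \<subseteq> \<pp>}"
    then obtain f where f: "\<And>U. U \<in> \<K> \<Longrightarrow> f U \<subseteq> carrier R \<and> U = {\<pp> \<in> Spec R. \<not> f U \<subseteq> \<pp>}"
      by metis
    have "\<Union> \<K> = {\<pp> \<in> Spec R. \<not> (\<Union>U\<in>\<K>. f U) \<subseteq> \<pp>}" using f by blast
    then show "\<exists>S\<subseteq>carrier R. \<Union> \<K> = {\<pp> \<in> Spec R. \<not> S \<subseteq> \<pp>}"
      using f by (intro exI[of _ "\<Union>U\<in>\<K>. f U"]) blast
  qed
  then show ?thesis by (simp add: zariski_def)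
qed

lemma topspace_zariski:
  fixes R (structure) assumes "cring R"
  shows "topspace (zariski R) = Spec R"
proof -
  interpret cring R by fact
  have 1: "U \<subseteq> Spec R" if "openin (zariski R) U" for U
    using that by (auto simp: openin_zariski[OF assms])
  have "\<not> {\<one>} \<subseteq> \<pp>" if "\<pp> \<in> Spec R" for \<pp>
  proof -
    interpret primeideal \<pp> R using that by (simp add: Spec_def)
    show ?thesis using one_imp_carrier I_notcarr by blast
  qed
  then have "openin (zariski R) (Spec R)"
    unfolding openin_zariski[OF assms] by (intro exI[of _ "{\<one>}"]) auto
  then show ?thesis using 1 by (meson openin_subset openin_topspace subset_antisym)
qed

lemma ring_group_algebra:
  assumes "group G" "finite (carrier G)"
  shows "ring (group_algebra G :: ('g \<Rightarrow> 'r::comm_ring_1) ring)"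
proof -
  interpret group G by fact
  let ?A = "group_algebra G :: ('g \<Rightarrow> 'r) ring"
  have reind: "(\<Sum>y\<in>carrier G. f y) = (\<Sum>z\<in>carrier G. f (a \<otimes>\<^bsub>G\<^esub> z))"
    if "a \<in> carrier G" for f :: "'g \<Rightarrow> 'r" and a
    by (rule sum.reindex_bij_witness[where i = "\<lambda>z. a \<otimes>\<^bsub>G\<^esub> z" and j = "\<lambda>y. inv\<^bsub>G\<^esub> a \<otimes>\<^bsub>G\<^esub> y"])
       (use that in \<open>auto simp: m_assoc[symmetric]\<close>)
  show ?thesis
  proof (rule ringI)
    show "abelian_group ?A"
    proof (rule abelian_groupI)
      fix u assume "u \<in> carrier ?A"
      then show "\<exists>v\<in>carrier ?A. v \<oplus>\<^bsub>?A\<^esub> u = \<zero>\<^bsub>?A\<^esub>"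
        by (intro bexI[of _ "\<lambda>x. - u x"]) (auto simp: group_algebra_def)
    qed (auto simp: group_algebra_def add_ac)
    show "Group.monoid ?A"
    proof (rule monoidI)
      fix u assume u: "u \<in> carrier ?A"
      show "\<one>\<^bsub>?A\<^esub> \<otimes>\<^bsub>?A\<^esub> u = u"
        using u assms by (auto simp: group_algebra_def group_elem_def fun_eq_iff if_distrib
          if_distribR sum.delta cong: if_cong)
      have "(\<Sum>y\<in>carrier G. u y * (if inv\<^bsub>G\<^esub> y \<otimes>\<^bsub>G\<^esub> x = \<one>\<^bsub>G\<^esub> then 1 else 0)) = u x"
        if x: "x \<in> carrier G" for x
      proof -
        have "(\<Sum>y\<in>carrier G. u y * (if inv\<^bsub>G\<^esub> y \<otimes>\<^bsub>G\<^esub> x = \<one>\<^bsub>G\<^esub> then 1 else 0))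
            = (\<Sum>y\<in>carrier G. if x = y then u y else 0)"
          using x by (intro sum.cong) (auto simp: inv_solve_left')
        then show ?thesis using x assms by simp
      qed
      then show "u \<otimes>\<^bsub>?A\<^esub> \<one>\<^bsub>?A\<^esub> = u"
        using u by (auto simp: group_algebra_def group_elem_def fun_eq_iff)
    next
      fix u v w assume "u \<in> carrier ?A" "v \<in> carrier ?A" "w \<in> carrier ?A"
      have "(\<Sum>y\<in>carrier G. (\<Sum>z\<in>carrier G. u z * v (inv\<^bsub>G\<^esub> z \<otimes>\<^bsub>G\<^esub> y)) * w (inv\<^bsub>G\<^esub> y \<otimes>\<^bsub>G\<^esub> x))
          = (\<Sum>z\<in>carrier G. u z * (\<Sum>y\<in>carrier G. v y * w (inv\<^bsub>G\<^esub> y \<otimes>\<^bsub>G\<^esub> (inv\<^bsub>G\<^esub> z \<otimes>\<^bsub>G\<^esub> x))))"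
        if x: "x \<in> carrier G" for x
      proof -
        have "(\<Sum>y\<in>carrier G. (\<Sum>z\<in>carrier G. u z * v (inv\<^bsub>G\<^esub> z \<otimes>\<^bsub>G\<^esub> y)) * w (inv\<^bsub>G\<^esub> y \<otimes>\<^bsub>G\<^esub> x))
          = (\<Sum>z\<in>carrier G. u z * (\<Sum>y\<in>carrier G. v (inv\<^bsub>G\<^esub> z \<otimes>\<^bsub>G\<^esub> y) * w (inv\<^bsub>G\<^esub> y \<otimes>\<^bsub>G\<^esub> x)))"
          unfolding sum_distrib_right sum_distrib_left by (subst sum.swap) (simp add: mult.assoc)
        also have "\<dots> = (\<Sum>z\<in>carrier G. u z * (\<Sum>y\<in>carrier G. v y * w (inv\<^bsub>G\<^esub> y \<otimes>\<^bsub>G\<^esub> (inv\<^bsub>G\<^esub> z \<otimes>\<^bsub>G\<^esub> x))))"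
        proof (rule sum.cong[OF refl], rule arg_cong2[where f = "(*)", OF refl])
          fix z assume z: "z \<in> carrier G"
          show "(\<Sum>y\<in>carrier G. v (inv\<^bsub>G\<^esub> z \<otimes>\<^bsub>G\<^esub> y) * w (inv\<^bsub>G\<^esub> y \<otimes>\<^bsub>G\<^esub> x))
            = (\<Sum>y\<in>carrier G. v y * w (inv\<^bsub>G\<^esub> y \<otimes>\<^bsub>G\<^esub> (inv\<^bsub>G\<^esub> z \<otimes>\<^bsub>G\<^esub> x)))"
            by (rule trans[OF reind[OF z] sum.cong[OF refl]]) (use z x in \<open>auto simp: m_assoc[symmetric] inv_mult_group\<close>)
        qed
        finally show ?thesis .
      qed
      then show "u \<otimes>\<^bsub>?A\<^esub> v \<otimes>\<^bsub>?A\<^esub> w = u \<otimes>\<^bsub>?A\<^esub> (v \<otimes>\<^bsub>?A\<^esub> w)"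
        by (auto simp: group_algebra_def fun_eq_iff)
    qed (auto simp: group_algebra_def group_elem_def)
  qed (auto simp: group_algebra_def fun_eq_iff algebra_simps sum.distrib)
qed

lemma unitary_iff:
  assumes "group G" "finite (carrier G)" "u \<in> carrier (group_algebra G)"
  shows "u \<in> unitary G \<longleftrightarrow>
    u \<otimes>\<^bsub>group_algebra G\<^esub> star G u = \<one>\<^bsub>group_algebra G\<^esub> \<and>
    star G u \<otimes>\<^bsub>group_algebra G\<^esub> u = \<one>\<^bsub>group_algebra G\<^esub> \<and> augmentation G u = 1"
proof -
  interpret A: ring "group_algebra G" using ring_group_algebra[OF assms(1,2)] .
  have s: "star G u \<in> carrier (group_algebra G)" by (auto simp: star_def group_algebra_def)
  show ?thesis
    unfolding unitary_def unitary_sch_def using assms(3) s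
    by (auto simp: Units_def) (metis A.inv_unique)
qed



lemma poly_eval_superset:
  assumes "finite S" "Poly_Mapping.keys p \<subseteq> S" "\<phi> 0 = 0"
  shows "poly_eval \<phi> u p = (\<Sum>m\<in>S. \<phi> (Poly_Mapping.lookup p m) *
     (\<Prod>x\<in>Poly_Mapping.keys m. u x ^ Poly_Mapping.lookup m x))"
  unfolding poly_eval_def using assms
  by (intro sum.mono_neutral_left) (auto simp: in_keys_iff)

lemma poly_eval_0: "poly_eval \<phi> u 0 = 0" by (simp add: poly_eval_def)

context
  fixes \<phi> :: "'k::comm_ring_1 \<Rightarrow> 'r::comm_ring_1"
  assumes phi_simps: "\<And>a b. \<phi> (a + b) = \<phi> a + \<phi> b" "\<And>a b. \<phi> (a * b) = \<phi> a * \<phi> b" "\<phi> 1 = 1"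
begin

lemma phi_0: "\<phi> 0 = 0" using phi_simps(1)[of 0 0] by simp

lemma poly_eval_add: "poly_eval \<phi> u (p + q) = poly_eval \<phi> u p + poly_eval \<phi> u q"
proof -
  let ?S = "Poly_Mapping.keys p \<union> Poly_Mapping.keys q"
  have "Poly_Mapping.keys (p + q) \<subseteq> ?S" by (rule Poly_Mapping.keys_add)
  then show ?thesis
    by (simp add: poly_eval_superset[of ?S] phi_0 lookup_add phi_simps distrib_right sum.distrib)
qed

lemma poly_eval_uminus: "poly_eval \<phi> u (- p) = - poly_eval \<phi> u p"
  using poly_eval_add[of u p "- p"] by (simp add: poly_eval_0 eq_neg_iff_add_eq_0 add.commute)

lemma poly_eval_diff: "poly_eval \<phi> u (p - q) = poly_eval \<phi> u p - poly_eval \<phi> u q"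
  using poly_eval_add[of u p "- q"] by (simp add: poly_eval_uminus)

lemma poly_eval_single:
  "poly_eval \<phi> u (Poly_Mapping.single m a) =
     \<phi> a * (\<Prod>x\<in>Poly_Mapping.keys m. u x ^ Poly_Mapping.lookup m x)"
  by (subst poly_eval_superset[of "{m}"]) (auto simp: phi_0 lookup_single)

lemma poly_eval_sum: "poly_eval \<phi> u (sum f A) = (\<Sum>i\<in>A. poly_eval \<phi> u (f i))"
  by (induction A rule: infinite_finite_induct) (auto simp: poly_eval_0 poly_eval_add)

lemma mono_eval_superset:
  assumes "finite S" "Poly_Mapping.keys m \<subseteq> S"
  shows "(\<Prod>x\<in>Poly_Mapping.keys m. (u x :: 'r) ^ Poly_Mapping.lookup m x) =
         (\<Prod>x\<in>S. u x ^ Poly_Mapping.lookup m x)"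
  using assms by (intro prod.mono_neutral_left) (auto simp: in_keys_iff)

lemma mono_eval_add:
  "(\<Prod>x\<in>Poly_Mapping.keys (m + n). (u x :: 'r) ^ Poly_Mapping.lookup (m + n) x) =
   (\<Prod>x\<in>Poly_Mapping.keys m. u x ^ Poly_Mapping.lookup m x) *
   (\<Prod>x\<in>Poly_Mapping.keys n. u x ^ Poly_Mapping.lookup n x)"
proof -
  let ?S = "Poly_Mapping.keys m \<union> Poly_Mapping.keys n"
  have "Poly_Mapping.keys (m + n) \<subseteq> ?S" by (rule Poly_Mapping.keys_add)
  then have "(\<Prod>x\<in>Poly_Mapping.keys (m + n). u x ^ Poly_Mapping.lookup (m + n) x) =
      (\<Prod>x\<in>?S. u x ^ Poly_Mapping.lookup (m + n) x)"
    by (intro mono_eval_superset) auto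
  then show ?thesis
    by (simp add: mono_eval_superset[of ?S m] mono_eval_superset[of ?S n] lookup_add power_add prod.distrib)
qed

lemma poly_expand: "(p :: 'x \<Rightarrow>\<^sub>0 'y::comm_monoid_add) =
    (\<Sum>m\<in>Poly_Mapping.keys p. Poly_Mapping.single m (Poly_Mapping.lookup p m))"
  by (rule poly_mapping_eqI)
    (auto simp: lookup_sum lookup_single when_def in_keys_iff)

lemma poly_eval_mult: "poly_eval \<phi> u (p * q) = poly_eval \<phi> u p * poly_eval \<phi> u q"
proof -
  have "poly_eval \<phi> u (p * q) = poly_eval \<phi> u
      ((\<Sum>m\<in>Poly_Mapping.keys p. Poly_Mapping.single m (Poly_Mapping.lookup p m)) *
       (\<Sum>m\<in>Poly_Mapping.keys q. Poly_Mapping.single m (Poly_Mapping.lookup q m)))"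
    by (simp flip: poly_expand)
  also have "\<dots> = poly_eval \<phi> u p * poly_eval \<phi> u q"
    unfolding sum_product
    by (simp add: poly_eval_sum mult_single poly_eval_single mono_eval_add phi_simps
        poly_eval_def[of _ _ p] poly_eval_def[of _ _ q] sum_product mult_ac)
  finally show ?thesis .
qed

lemma poly_eval_var: "poly_eval \<phi> u (poly_var x) = u x"
  by (simp add: poly_var_def poly_eval_single phi_simps)

lemma poly_eval_const: "poly_eval \<phi> u (poly_const a) = \<phi> a"
  by (simp add: poly_const_def poly_eval_single)

lemma poly_eval_1: "poly_eval \<phi> u 1 = 1"
  using poly_eval_const[of u 1] by (simp add: poly_const_def phi_simps)

end

lemma poly_ring_simps [simp]:
  "p \<otimes>\<^bsub>mpoly_ring V\<^esub> q = p * q" "p \<oplus>\<^bsub>mpoly_ring V\<^esub> q = p + q"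
  "\<one>\<^bsub>mpoly_ring V\<^esub> = 1" "\<zero>\<^bsub>mpoly_ring V\<^esub> = 0"
  by (auto simp: mpoly_ring_def)

lemma cring_poly_ring: "cring (mpoly_ring V :: (('v \<Rightarrow>\<^sub>0 nat) \<Rightarrow>\<^sub>0 'k::comm_ring_1) ring)"
proof -
  let ?R = "mpoly_ring V :: (('v \<Rightarrow>\<^sub>0 nat) \<Rightarrow>\<^sub>0 'k) ring"
  have c: "p + q \<in> carrier ?R" "p * q \<in> carrier ?R" "- p \<in> carrier ?R"
    if pq: "p \<in> carrier ?R" "q \<in> carrier ?R" for p q
  proof -
    show "p + q \<in> carrier ?R"
      using pq Poly_Mapping.keys_add[of p q] by (fastforce simp: mpoly_ring_def)
    have "Poly_Mapping.keys m \<subseteq> V" if "m \<in> Poly_Mapping.keys (p * q)" for m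
    proof -
      from that obtain a b where "a \<in> Poly_Mapping.keys p" "b \<in> Poly_Mapping.keys q" "m = a + b"
        using keys_mult[of p q] by blast
      then show ?thesis using pq Poly_Mapping.keys_add[of a b] by (fastforce simp: mpoly_ring_def)
    qed
    then show "p * q \<in> carrier ?R" by (simp add: mpoly_ring_def)
    show "- p \<in> carrier ?R" using pq by (simp add: mpoly_ring_def)
  qed
  have "0 \<in> carrier ?R" "1 \<in> carrier ?R" by (auto simp: mpoly_ring_def)
  with c show ?thesis
    by (intro cringI abelian_groupI comm_monoidI)
      (auto simp: algebra_simps intro!: bexI[of _ "- _"])
qed

lemma poly_var_in: "x \<in> V \<Longrightarrow> poly_var x \<in> carrier (mpoly_ring V)"
  by (auto simp: mpoly_ring_def poly_var_def)

lemma poly_const_in: "poly_const a \<in> carrier (mpoly_ring V)"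
  by (auto simp: mpoly_ring_def poly_const_def)


lemma poly_ring_minus: "p \<in> carrier (mpoly_ring V) \<Longrightarrow> \<ominus>\<^bsub>mpoly_ring V\<^esub> p = - p"
proof -
  assume p: "p \<in> carrier (mpoly_ring V)"
  interpret cring "mpoly_ring V :: (('a \<Rightarrow>\<^sub>0 nat) \<Rightarrow>\<^sub>0 'b) ring" by (rule cring_poly_ring)
  have "- p \<in> carrier (mpoly_ring V)" using p by (simp add: mpoly_ring_def)
  then show ?thesis using p by (intro minus_equality) auto
qed

lemma poly_ring_diff: "p \<in> carrier (mpoly_ring V) \<Longrightarrow> q \<in> carrier (mpoly_ring V) \<Longrightarrow>
   p \<ominus>\<^bsub>mpoly_ring V\<^esub> q = p - q"
  by (simp add: a_minus_def poly_ring_minus)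

lemma poly_ring_closed:
  fixes p q :: "('v \<Rightarrow>\<^sub>0 nat) \<Rightarrow>\<^sub>0 'k::comm_ring_1"
  assumes "p \<in> carrier (mpoly_ring V)" "q \<in> carrier (mpoly_ring V)"
  shows "p + q \<in> carrier (mpoly_ring V)" "p * q \<in> carrier (mpoly_ring V)"
     "p - q \<in> carrier (mpoly_ring V)" "- p \<in> carrier (mpoly_ring V)"
proof -
  interpret cring "mpoly_ring V :: (('v \<Rightarrow>\<^sub>0 nat) \<Rightarrow>\<^sub>0 'k) ring" by (rule cring_poly_ring)
  show "p + q \<in> carrier (mpoly_ring V)" using a_closed[OF assms] by simp
  show "p * q \<in> carrier (mpoly_ring V)" using m_closed[OF assms] by simp
  show "p - q \<in> carrier (mpoly_ring V)" using minus_closed[OF assms] assms by (simp add: poly_ring_diff)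
  show "- p \<in> carrier (mpoly_ring V)" using a_inv_closed[OF assms(1)] assms by (simp add: poly_ring_minus)
qed

lemma poly_ring_0_1: "0 \<in> carrier (mpoly_ring V)" "1 \<in> carrier (mpoly_ring V)"
  by (auto simp: mpoly_ring_def)

lemma poly_ring_sum:
  fixes f :: "'i \<Rightarrow> ('v \<Rightarrow>\<^sub>0 nat) \<Rightarrow>\<^sub>0 'k::comm_ring_1"
  shows "(\<And>i. i \<in> A \<Longrightarrow> f i \<in> carrier (mpoly_ring V)) \<Longrightarrow> sum f A \<in> carrier (mpoly_ring V)"
  by (induction A rule: infinite_finite_induct) (auto intro: poly_ring_closed poly_ring_0_1)

lemma generic_in: "generic_elem G x \<in> carrier (mpoly_ring (carrier G))"
  by (auto simp: generic_elem_def intro: poly_ring_0_1 poly_var_in)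

lemma star_generic_in: "star G (generic_elem G) x \<in> carrier (mpoly_ring (carrier G))"
  by (auto simp: star_def intro: poly_ring_0_1 generic_in)

lemma unitary_relations_in:
  "unitary_relations G \<subseteq> (carrier (mpoly_ring (carrier G)) :: (('g \<Rightarrow>\<^sub>0 nat) \<Rightarrow>\<^sub>0 'k::comm_ring_1) set)"
  unfolding unitary_relations_def Let_def
  by (auto simp: group_algebra_def group_elem_def augmentation_def
      intro!: poly_ring_closed poly_ring_sum poly_ring_0_1 generic_in star_generic_in)

lemma ideal_unitary_ideal:
  "ideal (unitary_ideal G) (mpoly_ring (carrier G) :: (('g \<Rightarrow>\<^sub>0 nat) \<Rightarrow>\<^sub>0 'k::comm_ring_1) ring)"
proof -
  interpret cring "mpoly_ring (carrier G) :: (('g \<Rightarrow>\<^sub>0 nat) \<Rightarrow>\<^sub>0 'k) ring" by (rule cring_poly_ring)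
  show ?thesis unfolding unitary_ideal_def by (rule genideal_ideal[OF unitary_relations_in])
qed

lemma cring_unitary_coord_ring:
  "cring (unitary_coord_ring G :: (('g \<Rightarrow>\<^sub>0 nat) \<Rightarrow>\<^sub>0 'k::comm_ring_1) set ring)"
  unfolding unitary_coord_ring_def by (rule ideal.quotient_is_cring[OF ideal_unitary_ideal cring_poly_ring])

context
  fixes \<phi> :: "'k::comm_ring_1 \<Rightarrow> 'r::comm_ring_1"
  assumes phi_simps: "\<And>a b. \<phi> (a + b) = \<phi> a + \<phi> b" "\<And>a b. \<phi> (a * b) = \<phi> a * \<phi> b" "\<phi> 1 = 1"
begin

lemmas evs = poly_eval_add[OF phi_simps] poly_eval_0 poly_eval_uminus[OF phi_simps]
   poly_eval_diff[OF phi_simps] poly_eval_sum[OF phi_simps]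
   poly_eval_mult[OF phi_simps] poly_eval_var[OF phi_simps] poly_eval_const[OF phi_simps]
   poly_eval_1[OF phi_simps]

lemma ideal_eval_kernel: "ideal {p \<in> carrier (mpoly_ring V). poly_eval \<phi> u p = 0} (mpoly_ring V)"
proof -
  interpret cring "mpoly_ring V :: (('a \<Rightarrow>\<^sub>0 nat) \<Rightarrow>\<^sub>0 'k) ring" by (rule cring_poly_ring)
  show ?thesis
  proof (rule idealI)
    show "subgroup {p \<in> carrier (mpoly_ring V). poly_eval \<phi> u p = 0} (add_monoid (mpoly_ring V))"
      by (rule add.subgroupI)
       (auto simp: evs poly_ring_minus a_inv_def[symmetric] intro: poly_ring_closed poly_ring_0_1)
  qed (auto simp: evs intro: poly_ring_closed poly_ring_0_1 ring_axioms)
qed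

text \<open>Homomorphisms of \<open>k\<close>-algebras from the coordinate ring to \<open>R\<close>, an algebra via \<open>\<phi>\<close>, are
  evaluations that vanish on \<open>unitary_ideal G\<close>; so the coordinate ring represents
  the functor \<open>unitary G\<close>.\<close>

lemma unitary_iff_eval:
  assumes "group G" "finite (carrier G)" "u \<in> carrier (group_algebra G)"
  shows "u \<in> unitary G \<longleftrightarrow> (\<forall>p\<in>unitary_ideal G. poly_eval \<phi> u p = 0)"
proof -
  interpret P: cring "mpoly_ring (carrier G) :: (('a \<Rightarrow>\<^sub>0 nat) \<Rightarrow>\<^sub>0 'k) ring" by (rule cring_poly_ring)
  let ?M = "{p \<in> carrier (mpoly_ring (carrier G)). poly_eval \<phi> u p = 0}"
  have g: "poly_eval \<phi> u (generic_elem G x) = u x" for x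
    using assms(3) by (auto simp: generic_elem_def evs group_algebra_def)
  have s: "poly_eval \<phi> u (star G (generic_elem G) x) = star G u x" for x
    by (simp add: star_def g evs)
  have o: "poly_eval \<phi> u (group_elem a x) = group_elem a x" for a x
    by (simp add: group_elem_def evs)
  have "u \<in> unitary G \<longleftrightarrow> unitary_relations G \<subseteq> ?M"
    using unitary_relations_in[of G, where ?'k = 'k]
    unfolding unitary_iff[OF assms] unitary_relations_def Let_def
    by (auto simp: group_algebra_def fun_eq_iff evs g s o augmentation_def)
       (auto simp: group_elem_def group.is_monoid[OF assms(1)])
  also have "\<dots> \<longleftrightarrow> unitary_ideal G \<subseteq> ?M"
    unfolding unitary_ideal_def
    using P.genideal_self[OF unitary_relations_in] P.genideal_minimal[OF ideal_eval_kernel] by blast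
  also have "\<dots> \<longleftrightarrow> (\<forall>p\<in>unitary_ideal G. poly_eval \<phi> u p = 0)"
    using ideal.Icarr[OF ideal_unitary_ideal[of G, where ?'k = 'k]] by blast
  finally show ?thesis .
qed

end

lemma group_elem_unitary:
  assumes "group G" "finite (carrier G)" "g \<in> carrier G"
  shows "group_elem g \<in> unitary G"
proof -
  interpret group G by fact
  have d: "(\<Sum>y\<in>carrier G. (if y = a then 1 else 0) * f y) = f a" if "a \<in> carrier G" for f :: "_ \<Rightarrow> 'z::comm_ring_1" and a
    using assms(2) that by (simp add: if_distrib if_distribR sum.delta cong: if_cong)
  have st: "star G (group_elem g) = group_elem (inv\<^bsub>G\<^esub> g)"
    using assms(3) by (auto simp: star_def group_elem_def fun_eq_iff)
  have m: "group_elem a \<otimes>\<^bsub>group_algebra G\<^esub> group_elem b = group_elem (a \<otimes>\<^bsub>G\<^esub> b)"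
    if "a \<in> carrier G" "b \<in> carrier G" for a b
    using that by (auto simp: group_algebra_def group_elem_def fun_eq_iff d inv_solve_left')
  have c: "group_elem g \<in> carrier (group_algebra G)"
    using assms(3) by (auto simp: group_algebra_def group_elem_def)
  show ?thesis
    unfolding unitary_iff[OF assms(1,2) c] st using assms(2,3)
    by (simp add: m augmentation_def) (simp add: group_algebra_def group_elem_def)
qed

lemma mem_unitary_point:
  fixes u :: "'g \<Rightarrow> 'k::field"
  assumes "group G" "finite (carrier G)" "u \<in> unitary G" "p \<in> carrier (mpoly_ring (carrier G))"
  shows "coord_class G p \<in> unitary_point G u \<longleftrightarrow> poly_eval (\<lambda>a. a) u p = 0"
proof -
  interpret P: cring "mpoly_ring (carrier G) :: (('g \<Rightarrow>\<^sub>0 nat) \<Rightarrow>\<^sub>0 'k) ring" by (rule cring_poly_ring)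
  have c: "u \<in> carrier (group_algebra G)"
    using assms(3) by (auto simp: unitary_def unitary_sch_def Units_def)
  have "poly_eval (\<lambda>a. a) u p = poly_eval (\<lambda>a. a) u q"
    if "q \<in> carrier (mpoly_ring (carrier G))" "coord_class G p = coord_class G q" for q
  proof -
    have "p \<ominus>\<^bsub>mpoly_ring (carrier G)\<^esub> q \<in> unitary_ideal G"
      using that assms(4) P.quotient_eq_iff_same_a_r_cos[OF ideal_unitary_ideal assms(4) that(1)]
      by (simp add: coord_class_def)
    then have "p - q \<in> unitary_ideal G" using that assms(4) by (simp add: poly_ring_diff)
    then have "poly_eval (\<lambda>a. a) u (p - q) = 0"
      using unitary_iff_eval[of "\<lambda>a::'k. a" G u] assms c by auto
    then show ?thesis by (subst (asm) poly_eval_diff) auto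
  qed
  moreover have "coord_class G p \<in> unitary_point G u \<longleftrightarrow>
      (\<exists>q\<in>carrier (mpoly_ring (carrier G)). poly_eval (\<lambda>a. a) u q = 0 \<and> coord_class G p = coord_class G q)"
    by (simp only: unitary_point_def) blast
  ultimately show ?thesis using assms(4) by metis
qed

lemma unitary_point_in_Spec:
  fixes u :: "'g \<Rightarrow> 'k::field"
  assumes "group G" "finite (carrier G)" "u \<in> unitary G"
  shows "unitary_point G u \<in> Spec (unitary_coord_ring G)"
proof -
  let ?P = "mpoly_ring (carrier G) :: (('g \<Rightarrow>\<^sub>0 nat) \<Rightarrow>\<^sub>0 'k) ring"
  let ?A = "unitary_coord_ring G :: (('g \<Rightarrow>\<^sub>0 nat) \<Rightarrow>\<^sub>0 'k) set ring"
  interpret P: cring ?P by (rule cring_poly_ring)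
  interpret A: cring ?A by (rule cring_unitary_coord_ring)
  interpret h: ring_hom_ring ?P ?A "coord_class G"
    using ideal.rcos_ring_hom_ring[OF ideal_unitary_ideal]
    unfolding unitary_coord_ring_def coord_class_def[abs_def] .
  note mem = mem_unitary_point[OF assms]
  have sur: "\<exists>p\<in>carrier ?P. a = coord_class G p" if "a \<in> carrier ?A" for a
    using that unfolding unitary_coord_ring_def coord_class_def by (auto simp: FactRing_def A_RCOSETS_defs a_r_coset_def)
  have sub: "unitary_point G u \<subseteq> carrier ?A" by (auto simp: unitary_point_def)
  have ev: "poly_eval (\<lambda>a. a) u (p + q) = poly_eval (\<lambda>a. a) u p + poly_eval (\<lambda>a. a) u q"
      "poly_eval (\<lambda>a. a) u (p * q) = poly_eval (\<lambda>a. a) u p * poly_eval (\<lambda>a. a) u q"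
      "poly_eval (\<lambda>a. a) u (- p) = - poly_eval (\<lambda>a. a) u p"
      "poly_eval (\<lambda>a. a) u 1 = 1"  "poly_eval (\<lambda>a. a) u 0 = 0" for p q
    by (rule poly_eval_add poly_eval_mult poly_eval_uminus poly_eval_1 poly_eval_0; simp)+
  have ad: "coord_class G p \<oplus>\<^bsub>?A\<^esub> coord_class G q = coord_class G (p + q)"
     "coord_class G p \<otimes>\<^bsub>?A\<^esub> coord_class G q = coord_class G (p * q)"
     "\<ominus>\<^bsub>?A\<^esub> coord_class G p = coord_class G (- p)"
    if "p \<in> carrier ?P" "q \<in> carrier ?P" for p q
    using h.hom_add[OF that] h.hom_mult[OF that] h.hom_a_inv[OF that(1)] that
    by (simp_all add: poly_ring_minus)
  have "primeideal (unitary_point G u) ?A"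
  proof (rule primeidealI)
    show "ideal (unitary_point G u) ?A"
    proof (rule idealI)
      show "subgroup (unitary_point G u) (add_monoid ?A)"
      proof (rule A.add.subgroupI)
        show "unitary_point G u \<noteq> {}" using mem[OF poly_ring_0_1(1)] ev by auto
      next
        fix a assume a: "a \<in> unitary_point G u"
        obtain p where "p \<in> carrier ?P" "a = coord_class G p" using sur[of a] a sub by auto
        moreover note a
        ultimately show "\<ominus>\<^bsub>?A\<^esub> a \<in> unitary_point G u"
          by (simp add: ad mem ev poly_ring_closed)
      next
        fix a b assume ab: "a \<in> unitary_point G u" "b \<in> unitary_point G u"
        obtain p where "p \<in> carrier ?P" "a = coord_class G p" using sur[of a] ab sub by auto
        moreover obtain q where "q \<in> carrier ?P" "b = coord_class G q" using sur[of b] ab sub by auto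
        moreover note ab
        ultimately show "a \<oplus>\<^bsub>?A\<^esub> b \<in> unitary_point G u"
          by (simp add: ad mem ev poly_ring_closed)
      qed (use sub in auto)
    next
      fix a x assume ax: "a \<in> unitary_point G u" "x \<in> carrier ?A"
      obtain p where "p \<in> carrier ?P" "a = coord_class G p" using sur[of a] ax sub by auto
      moreover obtain q where "q \<in> carrier ?P" "x = coord_class G q" using sur[of x] ax by auto
      moreover note ax
      ultimately show "x \<otimes>\<^bsub>?A\<^esub> a \<in> unitary_point G u" "a \<otimes>\<^bsub>?A\<^esub> x \<in> unitary_point G u"
        by (simp_all add: ad mem ev poly_ring_closed)
    qed (rule A.ring_axioms)
    show "carrier ?A \<noteq> unitary_point G u"
      using mem[OF poly_ring_0_1(2)] ev h.hom_closed[OF poly_ring_0_1(2)] by auto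
    fix a b assume ab: "a \<in> carrier ?A" "b \<in> carrier ?A" "a \<otimes>\<^bsub>?A\<^esub> b \<in> unitary_point G u"
    obtain p where "p \<in> carrier ?P" "a = coord_class G p" using sur[of a] ab by auto
    moreover obtain q where "q \<in> carrier ?P" "b = coord_class G q" using sur[of b] ab by auto
    moreover note ab(3)
    ultimately show "a \<in> unitary_point G u \<or> b \<in> unitary_point G u"
      by (simp add: ad mem ev poly_ring_closed)
  qed (rule A.is_cring)
  then show ?thesis by (simp add: Spec_def)
qed

end

theory Submission
  imports "HOL-Computational_Algebra.Polynomial_Factorial" Defs
    (* in this order, so that order is Coset.order and not Polynomial.order *)
begin

text \<open>The group \<open>G / N\<close>, where \<open>N\<close> is generated by the squares and the involutions, is elementary
  abelian, so its characters separate points; this is (i).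

  If \<open>\<epsilon>\<close> is an essential character with kernel \<open>H\<close>, then no element outside of \<open>H\<close> is its own inverse,
  and the unitarity relations make the partial augmentation \<open>\<Sum>x\<in>H. X\<^sub>x\<close> an idempotent of the
  coordinate ring. It has the value 1 at \<open>g \<in> H\<close> and 0 at \<open>g \<in> G - H\<close>, so \<open>G \<inter> U\<^sub>G\<^sup>0 \<subseteq> H\<close>.

  Conversely, \<open>h\<close> and \<open>h a\<close> are joined by a rational curve in \<open>U\<^sub>G\<close> if \<open>a\<close> is an involution or a square.
  For an involution \<open>s\<close> take \<open>u = (1 - t) + t s\<close>, for \<open>g\<^sup>2\<close> take \<open>u = v / v\<^sup>*\<close> with \<open>v = (1 - t) + t g\<close>. The
  curve \<open>h u\<close> is a unitary element over \<open>k(t)\<close>, whose point of the spectrum specializes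
  to the points \<open>h u(0)\<close> and \<open>h u(1)\<close>.\<close>

section \<open>Essential characters of finite groups\<close>

lemma (in group) order_two_ex:
  assumes "order G = 2"
  obtains c where "c \<noteq> \<one>" "carrier G = {\<one>, c}" "c \<otimes> c = \<one>"
proof -
  obtain a b where ab: "carrier G = {a, b}" "a \<noteq> b"
    using assms by (auto simp: order_def card_2_iff)
  have "\<exists>c. c \<noteq> \<one> \<and> carrier G = {\<one>, c}"
  proof (cases "a = \<one>")
    case True then show ?thesis using ab by (intro exI[of _ b]) auto
  next
    case False then show ?thesis using ab one_closed by (intro exI[of _ a]) auto
  qed
  then obtain c where c: "c \<noteq> \<one>" "carrier G = {\<one>, c}" by blast
  have cc: "c \<in> carrier G" using c(2) by blast
  have "c \<otimes> c \<noteq> c" using c(1) r_cancel_one[OF cc cc] by simp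
  moreover have "c \<otimes> c \<in> {\<one>, c}" unfolding c(2)[symmetric] using cc by (rule m_closed[OF cc])
  ultimately have "c \<otimes> c = \<one>" by simp
  then show ?thesis using that[OF c] by simp
qed

text \<open>If \<open>h m h m \<in> M\<close> for all \<open>m \<in> M\<close> then \<open>h\<close> normalizes \<open>M\<close>, so that adjoining \<open>h\<close> gives the
  subgroup \<open>M \<union> h M\<close>; by maximality it contains \<open>g\<close>.\<close>

lemma (in group) maximal_subgroup_avoiding:
  assumes "finite (carrier G)" "subgroup N G" and sq: "\<And>x. x \<in> carrier G \<Longrightarrow> x \<otimes> x \<in> N"
    and g: "g \<in> carrier G" "g \<notin> N"
  obtains M where "subgroup M G" "N \<subseteq> M" "g \<notin> M"
    "\<And>x y. x \<in> carrier G \<Longrightarrow> y \<in> carrier G \<Longrightarrow> x \<notin> M \<Longrightarrow> y \<notin> M \<Longrightarrow> x \<otimes> y \<in> M"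
proof -
  define \<M> where "\<M> = {M. subgroup M G \<and> N \<subseteq> M \<and> g \<notin> M}"
  have "finite \<M>"
    by (rule finite_subset[of _ "Pow (carrier G)"]) (auto simp: \<M>_def assms(1) dest: subgroup.subset)
  moreover have "N \<in> \<M>" using assms by (simp add: \<M>_def)
  ultimately obtain M where M: "M \<in> \<M>" "\<And>L. L \<in> \<M> \<Longrightarrow> M \<subseteq> L \<Longrightarrow> M = L"
    using finite_has_maximal2[of \<M> N] by auto
  interpret M: subgroup M G using M by (simp add: \<M>_def)
  have sqM: "x \<otimes> x \<in> M" if "x \<in> carrier G" for x using sq that M by (auto simp: \<M>_def)
  have conj: "h \<otimes> m \<otimes> h \<in> M" if h: "h \<in> carrier G" and m: "m \<in> M" for h m
  proof -
    have "(h \<otimes> m) \<otimes> (h \<otimes> m) \<otimes> inv m \<in> M" using sqM[of "h \<otimes> m"] h m by auto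
    then show ?thesis using h m M.mem_carrier by (simp add: m_assoc)
  qed
  have rep: "\<exists>m\<in>M. g = h \<otimes> m" if h: "h \<in> carrier G" "h \<notin> M" for h
  proof (rule ccontr)
    assume no: "\<not> ?thesis"
    define L where "L = M \<union> {h \<otimes> m | m. m \<in> M}"
    have R: "x \<otimes> m \<in> L" if "x \<in> L" "m \<in> M" for x m
      using that h M.mem_carrier by (auto simp: L_def m_assoc)
    have Lc: "L \<subseteq> carrier G" using h by (auto simp: L_def)
    have LL: "x \<otimes> y \<in> L" if xy: "x \<in> L" "y \<in> L" for x y
    proof -
      consider "y \<in> M" | m where "m \<in> M" "y = h \<otimes> m" using xy(2) by (auto simp: L_def)
      then show ?thesis
      proof cases
        case 1 then show ?thesis using R xy by blast
      next
        case (2 m)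
        have "x \<otimes> h \<in> L"
        proof (cases "x \<in> M")
          case True
          have "inv (h \<otimes> h) \<otimes> (h \<otimes> x \<otimes> h) \<in> M" using conj[OF h(1) True] sqM[OF h(1)] by auto
          moreover have "x \<otimes> h = h \<otimes> (inv (h \<otimes> h) \<otimes> (h \<otimes> x \<otimes> h))"
            using h True by (simp add: inv_mult_group m_assoc[symmetric])
          ultimately show ?thesis unfolding L_def by blast
        next
          case False
          then show ?thesis using xy conj[OF h(1)] by (auto simp: L_def)
        qed
        from R[OF this 2(1)] show ?thesis using 2 xy Lc h by (auto simp: m_assoc)
      qed
    qed
    have "subgroup L G"
    proof (rule subgroupI)
      fix a assume a: "a \<in> L"
      \<comment> \<open>\<open>inv a = a \<otimes> inv (a \<otimes> a)\<close>, so inverses come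
        from the squares and right multiplication by \<open>M\<close>.\<close>
      then have "a \<otimes> inv (a \<otimes> a) \<in> L" using R[OF a] sqM Lc by auto
      then show "inv a \<in> L" using a Lc by (auto simp: inv_mult_group m_assoc[symmetric])
    next
      show "L \<noteq> {}" using M.one_closed unfolding L_def by blast
    qed (rule Lc, rule LL)
    moreover have "g \<notin> L" using no M by (auto simp: L_def \<M>_def)
    moreover have "M \<subseteq> L" by (auto simp: L_def)
    moreover have "h \<in> L" using R[OF _ M.one_closed, of h] LL h r_one[OF h(1)] M.one_closed
      unfolding L_def by (metis (mono_tags, lifting) UnI2 mem_Collect_eq)
    ultimately show False using M(2)[of L] h M(1) by (auto simp: \<M>_def)
  qed
  have "x \<otimes> y \<in> M" if xy: "x \<in> carrier G" "y \<in> carrier G" "x \<notin> M" "y \<notin> M" for x y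
  proof -
    obtain m where m: "m \<in> M" "g = x \<otimes> m" using rep[OF xy(1,3)] by blast
    obtain n where n: "n \<in> M" "g = y \<otimes> n" using rep[OF xy(2,4)] by blast
    \<comment> \<open>This product is \<open>x \<otimes> y\<close>, since
      \<open>x = g \<otimes> inv m\<close> and \<open>y = g \<otimes> inv n\<close>.\<close>
    have "g \<otimes> inv m \<otimes> g \<otimes> inv n \<in> M" using conj[OF g(1)] m n by auto
    moreover have "g \<otimes> inv m = x" unfolding m(2) using m(1) xy by (simp add: m_assoc)
    moreover have "g \<otimes> inv n = y" unfolding n(2) using n(1) xy by (simp add: m_assoc)
    ultimately show ?thesis using g xy n by (simp add: m_assoc)
  qed
  then show ?thesis using that M M.subgroup_axioms by (auto simp: \<M>_def)
qed

text \<open>For \<open>g\<close> outside of the generated subgroup, take a subgroup \<open>M\<close>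
  maximal among those that contain it and avoid \<open>g\<close>. Two elements outside of
  \<open>M\<close> have their product in \<open>M\<close>, so sending \<open>M\<close> to 1 and the
  rest to \<open>c\<close> is a homomorphism; it is essential and nontrivial at
  \<open>g\<close>.\<close>

lemma essential_kernel_eq_generate:
  fixes G (structure)
  assumes "group G" "finite (carrier G)" "group C" "order C = 2"
  shows "essential_kernel G C =
           generate G ({g \<in> carrier G. group.ord G g = 2} \<union> {g \<otimes> g | g. g \<in> carrier G})"
    (is "_ = generate G ?S")
proof -
  interpret G: group G by fact
  interpret C: group C by fact
  obtain c where c: "c \<noteq> \<one>\<^bsub>C\<^esub>" "carrier C = {\<one>\<^bsub>C\<^esub>, c}" "c \<otimes>\<^bsub>C\<^esub> c = \<one>\<^bsub>C\<^esub>"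
    using C.order_two_ex[OF assms(4)] .
  have S: "?S \<subseteq> carrier G" by auto
  let ?N = "generate G ?S"
  have N: "subgroup ?N G" by (rule G.generate_is_subgroup[OF S])
  have "?N \<subseteq> kernel G C \<epsilon>" if e: "\<epsilon> \<in> essential_characters G C" for \<epsilon>
  proof -
    interpret e: group_hom G C \<epsilon>
      by (rule group_hom.intro) (use assms e in \<open>auto simp: group_hom_axioms_def essential_characters_def\<close>)
    have "\<epsilon> x \<otimes>\<^bsub>C\<^esub> \<epsilon> x = \<one>\<^bsub>C\<^esub>" if "x \<in> carrier G" for x
      using e.hom_closed[OF that] c by auto
    moreover have "x \<otimes> x = \<one>" if "x \<in> carrier G" "group.ord G x = 2" for x
      using G.pow_ord_eq_1[OF that(1)] that by (simp add: numeral_2_eq_2)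
    ultimately have "?S \<subseteq> kernel G C \<epsilon>" using e
      by (auto simp: kernel_def essential_characters_def)
    then show ?thesis by (rule G.generate_subgroup_incl[OF _ e.subgroup_kernel])
  qed
  moreover have "g \<in> ?N" if g: "g \<in> essential_kernel G C" for g
  proof (rule ccontr)
    assume gN: "g \<notin> ?N"
    \<comment> \<open>The trivial character makes the family nonempty, so the intersection of the
      kernels stays inside \<open>carrier G\<close>.\<close>
    have triv: "(\<lambda>_. \<one>\<^bsub>C\<^esub>) \<in> essential_characters G C"
      by (auto simp: essential_characters_def hom_def)
    then have gc: "g \<in> carrier G" using g by (auto simp: essential_kernel_def kernel_def)
    have sq: "x \<otimes> x \<in> ?N" if "x \<in> carrier G" for x
      using that by (intro generate.incl) blast
    obtain M where M: "subgroup M G" "?N \<subseteq> M" "g \<notin> M"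
       "\<And>x y. x \<in> carrier G \<Longrightarrow> y \<in> carrier G \<Longrightarrow> x \<notin> M \<Longrightarrow> y \<notin> M \<Longrightarrow> x \<otimes> y \<in> M"
      using G.maximal_subgroup_avoiding[OF assms(2) N sq gc gN] by blast
    interpret M: subgroup M G by fact
    define \<epsilon> where "\<epsilon> = (\<lambda>x. if x \<in> M then \<one>\<^bsub>C\<^esub> else c)"
    have nM: "x \<otimes> y \<notin> M" "y \<otimes> x \<notin> M" if "x \<in> M" "y \<in> carrier G" "y \<notin> M" for x y
    proof
      assume "x \<otimes> y \<in> M"
      then have "inv x \<otimes> (x \<otimes> y) \<in> M" using that by blast
      then show False using that M.mem_carrier by (simp add: G.m_assoc[symmetric])
    next
      show "y \<otimes> x \<notin> M"
      proof
        assume "y \<otimes> x \<in> M"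
        then have "(y \<otimes> x) \<otimes> inv x \<in> M" using that by blast
        then show False using that M.mem_carrier by (simp add: G.m_assoc)
      qed
    qed
    have "\<epsilon> \<in> hom G C"
      using c M(4) nM by (auto simp: hom_def \<epsilon>_def)
    \<comment> \<open>A nontrivial \<open>x\<close> of square 1 has order exactly 2, hence is one of
      the generators, which lie in \<open>M\<close>.\<close>
    moreover have "x \<in> M" if "x \<in> carrier G" "x \<otimes> x = \<one>" for x
    proof (cases "x = \<one>")
      case False
      have "G.ord x dvd 2" using that G.pow_eq_id[of x 2] by (simp add: numeral_2_eq_2)
      then have "G.ord x = 2"
        using False G.ord_eq_1[OF that(1)] by (metis two_is_prime_nat prime_nat_iff)
      then show ?thesis using that M(2) generate.incl[of x ?S G] by blast
    qed auto
    ultimately have "\<epsilon> \<in> essential_characters G C"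
      by (auto simp: essential_characters_def \<epsilon>_def)
    then have "\<epsilon> g = \<one>\<^bsub>C\<^esub>" using g by (auto simp: essential_kernel_def kernel_def)
    then show False using M(3) c by (simp add: \<epsilon>_def)
  qed
  ultimately show ?thesis unfolding essential_kernel_def by blast
qed

section \<open>Points of the spectrum\<close>

text \<open>A prime containing \<open>\<pp>\<close> lies in the closure of \<open>{\<pp>}\<close>,
  and the closure of a one-point set is connected.\<close>

lemma connected_component_of_zariski_le:
  fixes R (structure)
  assumes "cring R" "\<pp> \<in> Spec R" "\<qq> \<in> Spec R" "\<pp> \<subseteq> \<qq>"
  shows "connected_component_of (zariski R) \<pp> \<qq>"
proof -
  have "connectedin (zariski R) ((zariski R) closure_of {\<pp>})"
    using assms by (intro connectedin_closure_of) (simp add: topspace_zariski)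
  moreover have "\<pp> \<in> zariski R closure_of {\<pp>}" "\<qq> \<in> zariski R closure_of {\<pp>}"
    using assms by (auto simp: in_closure_of topspace_zariski openin_zariski)
  ultimately show ?thesis unfolding connected_component_of_def by blast
qed

text \<open>The idempotent \<open>e\<close> cuts the spectrum into the clopen sets \<open>D(e)\<close> and \<open>D(1 - e)\<close>.\<close>

lemma idempotent_separates_zariski:
  fixes R (structure)
  assumes "cring R" "e \<in> carrier R" "f \<in> carrier R" "e \<oplus> f = \<one>" "e \<otimes> f = \<zero>"
    and "connected_component_of (zariski R) \<pp> \<qq>" "e \<notin> \<pp>"
  shows "e \<notin> \<qq>"
proof
  assume eq: "e \<in> \<qq>"
  interpret cring R by fact
  have D: "openin (zariski R) {\<pp> \<in> Spec R. a \<notin> \<pp>}" if "a \<in> carrier R" for a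
    using that unfolding openin_zariski[OF assms(1)] by (intro exI[of _ "{a}"]) auto
  have excl: "e \<in> P \<or> f \<in> P" "\<not> (e \<in> P \<and> f \<in> P)" if "P \<in> Spec R" for P
  proof -
    interpret primeideal P R using that by (simp add: Spec_def)
    show "e \<in> P \<or> f \<in> P" using I_prime[of e f] assms zero_closed by simp
    show "\<not> (e \<in> P \<and> f \<in> P)"
      using a_closed[of e f] assms I_notcarr one_imp_carrier by auto
  qed
  obtain T where T: "connectedin (zariski R) T" "\<pp> \<in> T" "\<qq> \<in> T"
    using assms(6) by (auto simp: connected_component_of_def)
  have Ts: "T \<subseteq> Spec R"
    using connectedin_subset_topspace[OF T(1)] by (simp add: topspace_zariski[OF assms(1)])
  show False
    using connectedinD[OF T(1) D[OF assms(2)] D[OF assms(3)]] excl Ts T eq assms(7) by blast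
qed

section \<open>Points of the spectrum given by coordinates in a domain\<close>

lemma (in cring) primeideal_quotient:
  assumes "ideal I R" "primeideal J R" "I \<subseteq> J"
  shows "primeideal ((+>) I ` J) (R Quot I)"
proof -
  interpret I: ideal I R by fact
  interpret J: primeideal J R by fact
  interpret Q: cring "R Quot I" by (rule I.quotient_is_cring[OF is_cring])
  interpret h: ring_hom_ring R "R Quot I" "(+>) I" by (rule I.rcos_ring_hom_ring)
  \<comment> \<open>Since \<open>I \<subseteq> J\<close>, membership in the image of
    \<open>J\<close> does not depend on the representative of the coset.\<close>
  have mem: "I +> a \<in> (+>) I ` J \<longleftrightarrow> a \<in> J" if a: "a \<in> carrier R" for a
  proof
    assume "I +> a \<in> (+>) I ` J"
    then obtain b where b: "b \<in> J" "I +> a = I +> b" by blast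
    then have "a \<ominus> b \<in> J"
      using quotient_eq_iff_same_a_r_cos[OF assms(1) a J.Icarr[OF b(1)]] assms(3) by blast
    then have "(a \<ominus> b) \<oplus> b \<in> J" using b(1) J.a_closed by blast
    moreover have "(a \<ominus> b) \<oplus> b = a" using a J.Icarr[OF b(1)] by algebra
    ultimately show "a \<in> J" by simp
  qed blast
  have sur: "\<exists>a\<in>carrier R. A = I +> a" if "A \<in> carrier (R Quot I)" for A
    using that by (auto simp: FactRing_def A_RCOSETS_defs a_r_coset_def)
  show "primeideal ((+>) I ` J) (R Quot I)"
  proof (rule primeidealI)
    show "ideal ((+>) I ` J) (R Quot I)"
      by (rule ring_ideal_imp_quot_ideal[OF assms(1) J.ideal_axioms])
    show "carrier (R Quot I) \<noteq> (+>) I ` J"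
      using mem[OF one_closed] J.I_notcarr J.one_imp_carrier h.hom_closed[OF one_closed] by auto
    fix A B assume AB: "A \<in> carrier (R Quot I)" "B \<in> carrier (R Quot I)" "A \<otimes>\<^bsub>R Quot I\<^esub> B \<in> (+>) I ` J"
    obtain a b where ab: "a \<in> carrier R" "b \<in> carrier R" "A = I +> a" "B = I +> b"
      using sur AB(1,2) by metis
    have "I +> (a \<otimes> b) \<in> (+>) I ` J" using AB(3) h.hom_mult[OF ab(1,2)] ab(3,4) by simp
    then have "a \<otimes> b \<in> J" using mem[OF m_closed[OF ab(1,2)]] by blast
    then have "a \<in> J \<or> b \<in> J" using J.I_prime ab by blast
    then show "A \<in> (+>) I ` J \<or> B \<in> (+>) I ` J" using ab by blast
  qed (rule Q.is_cring)
qed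

lemma primeideal_eval_kernel:
  fixes \<phi> :: "'k::comm_ring_1 \<Rightarrow> 'r::idom"
  assumes phi: "\<And>a b. \<phi> (a + b) = \<phi> a + \<phi> b" "\<And>a b. \<phi> (a * b) = \<phi> a * \<phi> b" "\<phi> 1 = 1"
  shows "primeideal {p \<in> carrier (mpoly_ring V). poly_eval \<phi> u p = 0} (mpoly_ring V)"
proof (rule primeidealI[OF ideal_eval_kernel cring_poly_ring])
  show "carrier (mpoly_ring V) \<noteq> {p \<in> carrier (mpoly_ring V). poly_eval \<phi> u p = 0}"
  proof
    assume eq: "carrier (mpoly_ring V) = {p \<in> carrier (mpoly_ring V). poly_eval \<phi> u p = 0}"
    from subsetD[OF equalityD1[OF eq] poly_ring_0_1(2)] have "poly_eval \<phi> u 1 = 0" by simp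
    then show False using poly_eval_1[of \<phi> u, OF phi] by simp
  qed
qed (auto simp: poly_eval_mult[of \<phi>, OF phi] phi)

text \<open>The analogue of \<open>unitary_point\<close> for coordinates in a domain over
  \<open>k\<close>, with structure map \<open>\<phi>\<close>. For a unitary \<open>u\<close> over
  \<open>k(t)\<close> it is the generic point of the closure of the curve that \<open>u\<close>
  describes.\<close>

definition generic_point ::
    "('g, 'm) monoid_scheme \<Rightarrow> ('k::field \<Rightarrow> 'r::idom) \<Rightarrow> ('g \<Rightarrow> 'r) \<Rightarrow> (('g \<Rightarrow>\<^sub>0 nat) \<Rightarrow>\<^sub>0 'k) set set" where
  "generic_point G \<phi> u =
     coord_class G ` {p \<in> carrier (mpoly_ring (carrier G)). poly_eval \<phi> u p = 0}"

text \<open>Evaluation at a unitary \<open>u\<close> kills \<open>unitary_ideal G\<close>; its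
  kernel is prime because the target is a domain, and stays prime in the quotient.\<close>

lemma generic_point_in_Spec:
  fixes \<phi> :: "'k::field \<Rightarrow> 'r::idom"
  assumes phi: "\<And>a b. \<phi> (a + b) = \<phi> a + \<phi> b" "\<And>a b. \<phi> (a * b) = \<phi> a * \<phi> b" "\<phi> 1 = 1"
    and G: "group G" "finite (carrier G)" and u: "u \<in> unitary G"
  shows "generic_point G \<phi> u \<in> Spec (unitary_coord_ring G)"
proof -
  interpret P: cring "mpoly_ring (carrier G) :: (('a \<Rightarrow>\<^sub>0 nat) \<Rightarrow>\<^sub>0 'k) ring" by (rule cring_poly_ring)
  let ?J = "{p \<in> carrier (mpoly_ring (carrier G)). poly_eval \<phi> u p = 0}"
  have "u \<in> carrier (group_algebra G)" using u by (auto simp: unitary_def unitary_sch_def Units_def)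
  then have "unitary_ideal G \<subseteq> ?J"
    using unitary_iff_eval[of \<phi>, OF phi G] u ideal.Icarr[OF ideal_unitary_ideal] by blast
  then have "primeideal (coord_class G ` ?J) (unitary_coord_ring G)"
    unfolding unitary_coord_ring_def coord_class_def[abs_def]
    by (intro P.primeideal_quotient ideal_unitary_ideal primeideal_eval_kernel phi)
  then show ?thesis by (simp add: Spec_def generic_point_def)
qed

text \<open>The elements of \<open>k[t, 1/d]\<close> have values at points \<open>c\<close> with \<open>d(c) = 1\<close>; the values are compatible
  with sums and products.\<close>

definition has_value :: "'k::field poly \<Rightarrow> 'k \<Rightarrow> 'k poly fract \<Rightarrow> 'k \<Rightarrow> bool" where
  "has_value d c f a \<longleftrightarrow> (\<exists>q m. f * to_fract d ^ m = to_fract q \<and> poly q c = a)"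

text \<open>If \<open>f = 0\<close> then the numerator \<open>q\<close> is 0. Hence a polynomial
  that vanishes along a curve vanishes at its end points.\<close>

lemma has_value_0: "has_value d c 0 a \<Longrightarrow> a = 0"
  by (auto simp: has_value_def)

lemma to_fract_power: "to_fract (p ^ n) = to_fract p ^ n"
  by (induction n) auto

context
  fixes d :: "'k::field poly" and c :: 'k
  assumes d: "poly d c = 1"
begin

text \<open>Over the common denominator \<open>d ^ (m + n)\<close> the numerators pick up powers of
  \<open>d\<close>, whose value at \<open>c\<close> is 1.\<close>

lemma has_value_add:
  assumes "has_value d c f a" "has_value d c g b"
  shows "has_value d c (f + g) (a + b)"
proof -
  obtain q m where q: "f * to_fract d ^ m = to_fract q" "poly q c = a"
    using assms by (auto simp: has_value_def)
  obtain r n where r: "g * to_fract d ^ n = to_fract r" "poly r c = b"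
    using assms by (auto simp: has_value_def)
  have "(f + g) * to_fract d ^ (m + n)
      = (f * to_fract d ^ m) * to_fract d ^ n + (g * to_fract d ^ n) * to_fract d ^ m"
    by (simp add: algebra_simps power_add)
  then have "(f + g) * to_fract d ^ (m + n) = to_fract (q * d ^ n + r * d ^ m)"
    by (simp add: q r to_fract_power)
  moreover have "poly (q * d ^ n + r * d ^ m) c = a + b" by (simp add: q r d)
  ultimately show ?thesis unfolding has_value_def by blast
qed

lemma has_value_mult:
  assumes "has_value d c f a" "has_value d c g b"
  shows "has_value d c (f * g) (a * b)"
proof -
  obtain q m where q: "f * to_fract d ^ m = to_fract q" "poly q c = a"
    using assms by (auto simp: has_value_def)
  obtain r n where r: "g * to_fract d ^ n = to_fract r" "poly r c = b"
    using assms by (auto simp: has_value_def)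
  have "(f * g) * to_fract d ^ (m + n) = (f * to_fract d ^ m) * (g * to_fract d ^ n)"
    by (simp add: algebra_simps power_add)
  then have "(f * g) * to_fract d ^ (m + n) = to_fract (q * r)"
    by (simp add: q r)
  moreover have "poly (q * r) c = a * b" by (simp add: q r)
  ultimately show ?thesis unfolding has_value_def by blast
qed

lemma has_value_to_fract: "has_value d c (to_fract q) (poly q c)"
  unfolding has_value_def by (intro exI[of _ q] exI[of _ 0]) simp

lemma has_value_sum:
  "(\<And>i. i \<in> I \<Longrightarrow> has_value d c (f i) (a i)) \<Longrightarrow> has_value d c (\<Sum>i\<in>I. f i) (\<Sum>i\<in>I. a i)"
  using has_value_to_fract[of 0]
  by (induction I rule: infinite_finite_induct) (auto intro: has_value_add)

lemma has_value_prod: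
  "(\<And>i. i \<in> I \<Longrightarrow> has_value d c (f i) (a i)) \<Longrightarrow> has_value d c (\<Prod>i\<in>I. f i) (\<Prod>i\<in>I. a i)"
  using has_value_to_fract[of 1]
  by (induction I rule: infinite_finite_induct) (auto intro: has_value_mult)

lemma has_value_power: "has_value d c f a \<Longrightarrow> has_value d c (f ^ n) (a ^ n)"
  using has_value_to_fract[of 1] by (induction n) (auto intro: has_value_mult)

lemma has_value_poly_eval:
  assumes "\<And>x. has_value d c (u x) (a x)"
  shows "has_value d c (poly_eval (\<lambda>b. to_fract [:b:]) u p) (poly_eval (\<lambda>b. b) a p)"
proof -
  have "has_value d c (to_fract [:b:]) b" for b using has_value_to_fract[of "[:b:]"] by simp
  then show ?thesis
    unfolding poly_eval_def
    by (intro has_value_sum has_value_mult has_value_prod has_value_power assms) 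
qed

end

text \<open>\<open>d\<close> is a common denominator of the coordinates and has value 1 at
  \<open>c\<close>, so every polynomial over \<open>k\<close> that vanishes at \<open>u\<close> also
  vanishes at the end point. Thus the generic prime is contained in the prime of the end
  point.\<close>

lemma rational_curve_specializes:
  fixes u :: "'g \<Rightarrow> 'k::field poly fract"
  assumes G: "group G" "finite (carrier G)" and u: "u \<in> unitary G"
    and d: "poly d c = 1" and N: "\<And>x. u x * to_fract d = to_fract (N x)"
    and a: "(\<lambda>x. poly (N x) c) \<in> unitary G"
  shows "connected_component_of (zariski (unitary_coord_ring G))
     (generic_point G (\<lambda>b::'k. to_fract [:b:]) u) (unitary_point G (\<lambda>x. poly (N x) c))"
proof (rule connected_component_of_zariski_le[OF cring_unitary_coord_ring])
  show "generic_point G (\<lambda>b::'k. to_fract [:b:]) u \<in> Spec (unitary_coord_ring G)"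
  proof (rule generic_point_in_Spec[OF _ _ _ G u])
    show "to_fract [:1 :: 'k:] = 1" by (metis one_pCons to_fract_1)
  qed (simp_all flip: to_fract_add to_fract_mult)
  show "unitary_point G (\<lambda>x. poly (N x) c) \<in> Spec (unitary_coord_ring G)"
    by (rule unitary_point_in_Spec[OF G a])
  have "has_value d c (u x) (poly (N x) c)" for x
    unfolding has_value_def by (intro exI[of _ "N x"] exI[of _ 1]) (simp add: N)
  then have "poly_eval (\<lambda>b. b) (\<lambda>x. poly (N x) c) p = 0"
    if "poly_eval (\<lambda>b::'k. to_fract [:b:]) u p = 0" for p
    using has_value_poly_eval[OF d, of u "\<lambda>x. poly (N x) c" p] has_value_0 that by simp
  then show "generic_point G (\<lambda>b::'k. to_fract [:b:]) u \<subseteq> unitary_point G (\<lambda>x. poly (N x) c)"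
    by (auto simp: generic_point_def unitary_point_def)
qed

text \<open>Both ends are specializations of the same generic point. The equations \<open>vw\<close>
  let them be given as known unitary elements instead of values of \<open>N\<close>.\<close>

lemma rational_curve_connected:
  fixes u :: "'g \<Rightarrow> 'k::field poly fract"
  assumes G: "group G" "finite (carrier G)" and u: "u \<in> unitary G"
    and N: "\<And>x. u x * to_fract d = to_fract (N x)"
    and d: "poly d b = 1" "poly d c = 1"
    and vw: "v = (\<lambda>x. poly (N x) b)" "w = (\<lambda>x. poly (N x) c)" and unit: "v \<in> unitary G" "w \<in> unitary G"
  shows "connected_component_of (zariski (unitary_coord_ring G)) (unitary_point G v) (unitary_point G w)"
proof -
  have "connected_component_of (zariski (unitary_coord_ring G))
     (generic_point G (\<lambda>b::'k. to_fract [:b:]) u) (unitary_point G v)"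
    "connected_component_of (zariski (unitary_coord_ring G))
     (generic_point G (\<lambda>b::'k. to_fract [:b:]) u) (unitary_point G w)"
    using rational_curve_specializes[OF G u d(1) N unit(1)[unfolded vw]]
      rational_curve_specializes[OF G u d(2) N unit(2)[unfolded vw]]
    unfolding vw by blast+
  then show ?thesis by (meson connected_component_of_sym connected_component_of_trans)
qed

section \<open>Unitary elements of the group algebra\<close>

context
  fixes G :: "('g, 'm) monoid_scheme" (structure)
  assumes G: "group G" and fin: "finite (carrier G)"
begin

interpretation G: group G by (rule G)

abbreviation A where "A \<equiv> group_algebra G :: ('g \<Rightarrow> 'r::comm_ring_1) ring"

lemma group_elem_outside: "g \<in> carrier G \<Longrightarrow> x \<notin> carrier G \<Longrightarrow> group_elem g x = 0"
  by (auto simp: group_elem_def)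

lemma star_in: "star G u \<in> carrier A"
  by (auto simp: star_def group_algebra_def)

lemma group_algebra_mult_apply:
  "x \<in> carrier G \<Longrightarrow> (u \<otimes>\<^bsub>A\<^esub> v) x = (\<Sum>y\<in>carrier G. u y * v (inv y \<otimes> x))"
  by (simp add: group_algebra_def)

lemma group_algebra_eqI:
  assumes "u \<in> carrier A" "v \<in> carrier A" "\<And>x. x \<in> carrier G \<Longrightarrow> u x = v x"
  shows "u = v"
proof
  fix x show "u x = v x"
    using assms by (cases "x \<in> carrier G") (auto simp: group_algebra_def)
qed

lemma group_algebra_one: "\<one>\<^bsub>A\<^esub> = group_elem \<one>"
  by (simp add: group_algebra_def)

lemma group_elem_shift:
  assumes "g \<in> carrier G" "a \<in> carrier G" "x \<in> carrier G"
  shows "group_elem a (inv g \<otimes> x) = group_elem (g \<otimes> a) x"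
    and "group_elem a (x \<otimes> inv g) = group_elem (a \<otimes> g) x"
  using assms by (auto simp: group_elem_def G.inv_solve_left' G.inv_solve_right')

lemma sum_group_elem:
  fixes f :: "'g \<Rightarrow> 'r::comm_ring_1"
  assumes "a \<in> carrier G"
  shows "(\<Sum>y\<in>carrier G. group_elem a y * f y) = f a"
  using fin assms by (simp add: group_elem_def if_distrib if_distribR sum.delta cong: if_cong)

lemma star_mult:
  fixes u v :: "'g \<Rightarrow> 'r::comm_ring_1"
  shows "star G (u \<otimes>\<^bsub>A\<^esub> v) = star G v \<otimes>\<^bsub>A\<^esub> star G u"
proof
  fix x
  show "star G (u \<otimes>\<^bsub>A\<^esub> v) x = (star G v \<otimes>\<^bsub>A\<^esub> star G u) x"
  proof (cases "x \<in> carrier G")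
    case True
    have "(\<Sum>y\<in>carrier G. u y * v (inv y \<otimes> inv x))
        = (\<Sum>z\<in>carrier G. star G v z * star G u (inv z \<otimes> x))"
      by (rule sum.reindex_bij_witness[where i = "\<lambda>z. inv x \<otimes> z" and j = "\<lambda>y. x \<otimes> y"])
        (use True in \<open>auto simp: star_def G.m_assoc[symmetric] G.inv_mult_group mult.commute\<close>)
    then show ?thesis using True by (simp add: star_def group_algebra_mult_apply)
  qed (simp add: star_def group_algebra_def)
qed

lemma star_star: "u \<in> carrier A \<Longrightarrow> star G (star G u) = u"
  by (auto simp: star_def group_algebra_def fun_eq_iff)

lemma star_group_elem: "g \<in> carrier G \<Longrightarrow> star G (group_elem g) = group_elem (inv g)"
  by (auto simp: star_def group_elem_def fun_eq_iff)

lemma augmentation_mult: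
  fixes u v :: "'g \<Rightarrow> 'r::comm_ring_1"
  shows "augmentation G (u \<otimes>\<^bsub>A\<^esub> v) = augmentation G u * augmentation G v"
proof -
  have "(\<Sum>x\<in>carrier G. v (inv y \<otimes> x)) = (\<Sum>x\<in>carrier G. v x)" if "y \<in> carrier G" for y
    by (rule sum.reindex_bij_witness[where i = "\<lambda>x. y \<otimes> x" and j = "\<lambda>x. inv y \<otimes> x"])
      (use that in \<open>auto simp: G.m_assoc[symmetric]\<close>)
  then have "(\<Sum>y\<in>carrier G. u y * (\<Sum>x\<in>carrier G. v (inv y \<otimes> x))) = augmentation G u * augmentation G v"
    by (simp add: augmentation_def sum_distrib_right)
  then show ?thesis
    unfolding sum_distrib_left augmentation_def[of G "_ \<otimes>\<^bsub>A\<^esub> _"]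
    by (subst (asm) sum.swap) (simp add: group_algebra_mult_apply)
qed

lemma augmentation_star: "augmentation G (star G u) = augmentation G u"
  unfolding augmentation_def
  by (rule sum.reindex_bij_witness[where i = "\<lambda>x. inv x" and j = "\<lambda>x. inv x"])
    (auto simp: star_def)

lemma augmentation_group_elem: "g \<in> carrier G \<Longrightarrow> augmentation G (group_elem g) = 1"
  using fin by (simp add: augmentation_def group_elem_def)

lemma unitary_in: "u \<in> unitary G \<Longrightarrow> u \<in> carrier A"
  by (auto simp: unitary_def unitary_sch_def Units_def)

lemma unitary_mult:
  fixes u v :: "'g \<Rightarrow> 'r::comm_ring_1"
  assumes "u \<in> unitary G" "v \<in> unitary G"
  shows "u \<otimes>\<^bsub>A\<^esub> v \<in> unitary G"
proof -
  interpret A: ring "A :: ('g \<Rightarrow> 'r) ring" by (rule ring_group_algebra[OF G fin])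
  note [simp] = unitary_in[OF assms(1)] unitary_in[OF assms(2)] star_in
  have u: "u \<otimes>\<^bsub>A\<^esub> star G u = \<one>\<^bsub>A\<^esub>" "star G u \<otimes>\<^bsub>A\<^esub> u = \<one>\<^bsub>A\<^esub>" "augmentation G u = 1"
    using assms(1) by (simp_all add: unitary_iff[OF G fin])
  have v: "v \<otimes>\<^bsub>A\<^esub> star G v = \<one>\<^bsub>A\<^esub>" "star G v \<otimes>\<^bsub>A\<^esub> v = \<one>\<^bsub>A\<^esub>" "augmentation G v = 1"
    using assms(2) by (simp_all add: unitary_iff[OF G fin])
  have "(u \<otimes>\<^bsub>A\<^esub> v) \<otimes>\<^bsub>A\<^esub> (star G v \<otimes>\<^bsub>A\<^esub> star G u) = u \<otimes>\<^bsub>A\<^esub> (v \<otimes>\<^bsub>A\<^esub> star G v) \<otimes>\<^bsub>A\<^esub> star G u"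
    by (simp add: A.m_assoc)
  moreover have "(star G v \<otimes>\<^bsub>A\<^esub> star G u) \<otimes>\<^bsub>A\<^esub> (u \<otimes>\<^bsub>A\<^esub> v) = star G v \<otimes>\<^bsub>A\<^esub> (star G u \<otimes>\<^bsub>A\<^esub> u) \<otimes>\<^bsub>A\<^esub> v"
    by (simp add: A.m_assoc)
  ultimately show ?thesis
    by (simp add: unitary_iff[OF G fin] star_mult augmentation_mult u v)
qed

text \<open>This is \<open>v / star v\<close>, with \<open>w\<close> the inverse of
  \<open>star v\<close>. As \<open>v\<close> commutes with its star, so does \<open>w\<close>, and
  the product with the star regroups into \<open>v \<otimes> star w\<close> and
  \<open>w \<otimes> star v\<close>, which are both 1.\<close>

lemma unitary_quotient:
  fixes v w :: "'g \<Rightarrow> 'r::comm_ring_1"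
  assumes vw: "v \<in> carrier A" "w \<in> carrier A" "star G v \<otimes>\<^bsub>A\<^esub> w = \<one>\<^bsub>A\<^esub>" "w \<otimes>\<^bsub>A\<^esub> star G v = \<one>\<^bsub>A\<^esub>"
    and comm: "v \<otimes>\<^bsub>A\<^esub> star G v = star G v \<otimes>\<^bsub>A\<^esub> v" and aug: "augmentation G v = 1"
  shows "v \<otimes>\<^bsub>A\<^esub> w \<in> unitary G"
proof -
  interpret A: ring "A :: ('g \<Rightarrow> 'r) ring" by (rule ring_group_algebra[OF G fin])
  note [simp] = vw(1,2) star_in
  have st1: "star G \<one>\<^bsub>A\<^esub> = (\<one>\<^bsub>A\<^esub> :: 'g \<Rightarrow> 'r)" by (simp add: group_algebra_one star_group_elem)
  have w': "star G w \<otimes>\<^bsub>A\<^esub> v = \<one>\<^bsub>A\<^esub>" "v \<otimes>\<^bsub>A\<^esub> star G w = \<one>\<^bsub>A\<^esub>"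
    using arg_cong[OF vw(3), of "star G"] arg_cong[OF vw(4), of "star G"]
    by (simp_all add: star_mult star_star st1)
  \<comment> \<open>The unit is inserted as
    \<open>star v \<otimes> v \<otimes> star w \<otimes> w\<close>; swapping \<open>star v\<close>
    and \<open>v\<close> then cancels the left factors.\<close>
  have "w \<otimes>\<^bsub>A\<^esub> star G w = w \<otimes>\<^bsub>A\<^esub> star G w \<otimes>\<^bsub>A\<^esub> (star G v \<otimes>\<^bsub>A\<^esub> (v \<otimes>\<^bsub>A\<^esub> star G w) \<otimes>\<^bsub>A\<^esub> w)"
    using w' vw by simp
  also have "\<dots> = w \<otimes>\<^bsub>A\<^esub> star G w \<otimes>\<^bsub>A\<^esub> (star G v \<otimes>\<^bsub>A\<^esub> v) \<otimes>\<^bsub>A\<^esub> star G w \<otimes>\<^bsub>A\<^esub> w"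
    by (simp add: A.m_assoc)
  also have "\<dots> = w \<otimes>\<^bsub>A\<^esub> (star G w \<otimes>\<^bsub>A\<^esub> v) \<otimes>\<^bsub>A\<^esub> star G v \<otimes>\<^bsub>A\<^esub> star G w \<otimes>\<^bsub>A\<^esub> w"
    unfolding comm[symmetric] by (simp add: A.m_assoc)
  also have "\<dots> = star G w \<otimes>\<^bsub>A\<^esub> w" using w' vw by simp
  finally have comm_w: "w \<otimes>\<^bsub>A\<^esub> star G w = star G w \<otimes>\<^bsub>A\<^esub> w" .
  have "(v \<otimes>\<^bsub>A\<^esub> w) \<otimes>\<^bsub>A\<^esub> (star G w \<otimes>\<^bsub>A\<^esub> star G v) = v \<otimes>\<^bsub>A\<^esub> (w \<otimes>\<^bsub>A\<^esub> star G w) \<otimes>\<^bsub>A\<^esub> star G v"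
    by (simp add: A.m_assoc)
  also have "\<dots> = (v \<otimes>\<^bsub>A\<^esub> star G w) \<otimes>\<^bsub>A\<^esub> (w \<otimes>\<^bsub>A\<^esub> star G v)"
    unfolding comm_w by (simp add: A.m_assoc)
  finally have 1: "(v \<otimes>\<^bsub>A\<^esub> w) \<otimes>\<^bsub>A\<^esub> (star G w \<otimes>\<^bsub>A\<^esub> star G v) = \<one>\<^bsub>A\<^esub>" using w' vw by simp
  have "(star G w \<otimes>\<^bsub>A\<^esub> star G v) \<otimes>\<^bsub>A\<^esub> (v \<otimes>\<^bsub>A\<^esub> w) = star G w \<otimes>\<^bsub>A\<^esub> (star G v \<otimes>\<^bsub>A\<^esub> v) \<otimes>\<^bsub>A\<^esub> w"
    by (simp add: A.m_assoc)
  also have "\<dots> = (star G w \<otimes>\<^bsub>A\<^esub> v) \<otimes>\<^bsub>A\<^esub> (star G v \<otimes>\<^bsub>A\<^esub> w)"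
    unfolding comm[symmetric] by (simp add: A.m_assoc)
  finally have 2: "(star G w \<otimes>\<^bsub>A\<^esub> star G v) \<otimes>\<^bsub>A\<^esub> (v \<otimes>\<^bsub>A\<^esub> w) = \<one>\<^bsub>A\<^esub>" using w' vw by simp
  have "augmentation G w = 1"
    using arg_cong[OF vw(3), of "augmentation G"] aug
    by (simp add: augmentation_mult augmentation_star group_algebra_one augmentation_group_elem)
  with 1 2 aug show ?thesis
    by (simp add: unitary_iff[OF G fin] star_mult augmentation_mult)
qed

text \<open>With \<open>\<alpha> = 1 - t\<close> and \<open>\<beta> = t\<close> this runs from 1 to
  \<open>g\<close>. Free coefficients serve both \<open>k[t]\<close> and
  \<open>k(t)\<close>.\<close>

definition line :: "'r \<Rightarrow> 'r \<Rightarrow> 'g \<Rightarrow> 'g \<Rightarrow> 'r::comm_ring_1" where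
  "line \<alpha> \<beta> g = (\<lambda>x. \<alpha> * group_elem \<one> x + \<beta> * group_elem g x)"

lemma line_in: "g \<in> carrier G \<Longrightarrow> line \<alpha> \<beta> g \<in> carrier A"
  by (auto simp: line_def group_algebra_def group_elem_outside)

lemma star_line: "g \<in> carrier G \<Longrightarrow> star G (line \<alpha> \<beta> g) = line \<alpha> \<beta> (inv g)"
  by (auto simp: star_def line_def group_elem_def fun_eq_iff)

lemma augmentation_line: "g \<in> carrier G \<Longrightarrow> augmentation G (line \<alpha> \<beta> g) = \<alpha> + \<beta>"
  by (simp add: augmentation_def line_def sum.distrib augmentation_group_elem[unfolded augmentation_def]
      flip: sum_distrib_left)

lemma line_mult_apply:
  fixes u :: "'g \<Rightarrow> 'r::comm_ring_1"
  assumes "g \<in> carrier G" "x \<in> carrier G"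
  shows "(line \<alpha> \<beta> g \<otimes>\<^bsub>A\<^esub> u) x = \<alpha> * u x + \<beta> * u (inv g \<otimes> x)"
  using assms
  by (simp add: group_algebra_mult_apply line_def distrib_right sum.distrib mult.assoc
      sum_group_elem flip: sum_distrib_left)

lemma mult_line_apply:
  fixes u :: "'g \<Rightarrow> 'r::comm_ring_1"
  assumes "g \<in> carrier G" "x \<in> carrier G"
  shows "(u \<otimes>\<^bsub>A\<^esub> line \<alpha> \<beta> g) x = \<alpha> * u x + \<beta> * u (x \<otimes> inv g)"
proof -
  have e: "group_elem a (inv y \<otimes> x) = group_elem (x \<otimes> inv a) y" if "a \<in> carrier G" "y \<in> carrier G" for a y
    using that assms by (auto simp: group_elem_def G.inv_solve_left' G.inv_solve_right' G.m_assoc)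
  have "(u \<otimes>\<^bsub>A\<^esub> line \<alpha> \<beta> g) x = (\<Sum>y\<in>carrier G. \<alpha> * (group_elem x y * u y) + \<beta> * (group_elem (x \<otimes> inv g) y * u y))"
    using assms by (simp add: group_algebra_mult_apply line_def e algebra_simps cong: sum.cong)
  then show ?thesis using assms by (simp add: sum.distrib sum_group_elem flip: sum_distrib_left)
qed

lemma group_elem_mult_apply:
  assumes "g \<in> carrier G" "x \<in> carrier G"
  shows "(group_elem g \<otimes>\<^bsub>A\<^esub> u) x = u (inv g \<otimes> x)"
  using assms by (simp add: group_algebra_mult_apply sum_group_elem)

text \<open>Since \<open>inv g = g\<close>, the element is its own star. Its square is
  \<open>\<alpha>\<^sup>2 + \<beta>\<^sup>2 + 2 \<alpha> \<beta> g\<close>, which is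
  \<open>(\<alpha> + \<beta>)\<^sup>2 = 1\<close> in characteristic 2.\<close>

lemma unitary_line:
  fixes \<alpha> \<beta> :: "'r::comm_ring_1"
  assumes "(1 + 1 :: 'r) = 0" "\<alpha> + \<beta> = 1" "g \<in> carrier G" "g \<otimes> g = \<one>"
  shows "line \<alpha> \<beta> g \<in> unitary G"
proof -
  have i: "inv g = g" using assms by (simp add: G.inv_equality)
  have sq: "\<alpha> * \<alpha> + \<beta> * \<beta> = 1"
  proof -
    have "\<alpha> * \<alpha> + \<beta> * \<beta> = (\<alpha> + \<beta>) * (\<alpha> + \<beta>) - (1 + 1) * (\<alpha> * \<beta>)" by (simp add: algebra_simps)
    then show ?thesis using assms by simp
  qed
  have two: "\<alpha> * \<beta> + \<beta> * \<alpha> = 0"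
  proof -
    have "\<alpha> * \<beta> + \<beta> * \<alpha> = (1 + 1) * (\<alpha> * \<beta>)" by (simp add: algebra_simps)
    then show ?thesis using assms by simp
  qed
  interpret A: ring "A :: ('g \<Rightarrow> 'r) ring" by (rule ring_group_algebra[OF G fin])
  have "line \<alpha> \<beta> g \<otimes>\<^bsub>A\<^esub> line \<alpha> \<beta> g = \<one>\<^bsub>A\<^esub>"
  proof (rule group_algebra_eqI)
    fix x assume x: "x \<in> carrier G"
    have "(line \<alpha> \<beta> g \<otimes>\<^bsub>A\<^esub> line \<alpha> \<beta> g) x
      = \<alpha> * (\<alpha> * group_elem \<one> x + \<beta> * group_elem g x) + \<beta> * (\<alpha> * group_elem g x + \<beta> * group_elem \<one> x)"
      using assms(3,4) x
      by (simp add: line_mult_apply) (simp add: line_def group_elem_shift)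
    also have "\<dots> = (\<alpha> * \<alpha> + \<beta> * \<beta>) * group_elem \<one> x + (\<alpha> * \<beta> + \<beta> * \<alpha>) * group_elem g x"
      by (simp add: algebra_simps)
    finally show "(line \<alpha> \<beta> g \<otimes>\<^bsub>A\<^esub> line \<alpha> \<beta> g) x = \<one>\<^bsub>A\<^esub> x"
      by (simp add: sq two group_algebra_one)
  qed (use assms in \<open>auto intro: line_in\<close>)
  then show ?thesis
    using assms by (simp add: unitary_iff[OF G fin line_in] star_line i augmentation_line)
qed

text \<open>The homogeneous geometric sum: its product with \<open>\<alpha> - \<beta> g\<close> is
  \<open>\<alpha> ^ n - \<beta> ^ n g ^ n\<close>. In characteristic 2 the signs disappear; if
  \<open>g ^ n = 1\<close>, division by the scalar \<open>\<alpha> ^ n + \<beta> ^ n\<close>, when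
  invertible, yields the inverse of \<open>\<alpha> + \<beta> g\<close>.\<close>

definition geom :: "'r \<Rightarrow> 'r \<Rightarrow> 'g \<Rightarrow> nat \<Rightarrow> 'g \<Rightarrow> 'r::comm_ring_1" where
  "geom \<alpha> \<beta> g n = (\<lambda>x. \<Sum>i<n. \<alpha> ^ (n - 1 - i) * \<beta> ^ i * group_elem (g [^] i) x)"

lemma geom_Suc: "geom \<alpha> \<beta> g (Suc n) x = \<alpha> * geom \<alpha> \<beta> g n x + \<beta> ^ n * group_elem (g [^] n) x"
proof -
  have "(\<Sum>i<n. \<alpha> ^ (n - i) * \<beta> ^ i * group_elem (g [^] i) x)
      = (\<Sum>i<n. \<alpha> * (\<alpha> ^ (n - 1 - i) * \<beta> ^ i * group_elem (g [^] i) x))"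
  proof (rule sum.cong[OF refl])
    fix i assume "i \<in> {..<n}"
    then have "\<alpha> ^ (n - i) = \<alpha> * \<alpha> ^ (n - 1 - i)"
      using power_Suc[of \<alpha> "n - 1 - i"] by (simp add: Suc_diff_Suc)
    then show "\<alpha> ^ (n - i) * \<beta> ^ i * group_elem (g [^] i) x
      = \<alpha> * (\<alpha> ^ (n - 1 - i) * \<beta> ^ i * group_elem (g [^] i) x)" by (simp add: mult.assoc)
  qed
  then show ?thesis by (simp add: geom_def sum_distrib_left)
qed

lemma geom_in: "g \<in> carrier G \<Longrightarrow> geom \<alpha> \<beta> g n \<in> carrier A"
  by (auto simp: geom_def group_algebra_def group_elem_outside intro!: sum.neutral)

text \<open>With \<open>y = inv g \<otimes> x\<close> or \<open>y = x \<otimes> inv g\<close>, the left-hand side is the coefficient at \<open>x\<close> of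
  \<open>(\<alpha> + \<beta> g) * geom \<alpha> \<beta> g n\<close> or of \<open>geom \<alpha> \<beta> g n * (\<alpha> + \<beta> g)\<close>.\<close>

lemma geom_telescope:
  fixes \<alpha> \<beta> :: "'r::comm_ring_1"
  assumes two: "(1 + 1 :: 'r) = 0"
    and shift: "\<And>i::nat. group_elem (g [^] i) y = (group_elem (g [^] Suc i) x :: 'r)"
  shows "\<alpha> * geom \<alpha> \<beta> g n x + \<beta> * geom \<alpha> \<beta> g n y
      = \<alpha> ^ n * group_elem \<one> x + \<beta> ^ n * group_elem (g [^] n) x" (is "?L n = _")
proof -
  have double: "a + a = 0" for a :: 'r
    using arg_cong[OF two, of "\<lambda>c. c * a"] by (simp add: distrib_right)
  show ?thesis
  proof (induction n)
    \<comment> \<open>The empty sum gives 0 on the left; the right-hand side is twice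
      \<open>group_elem \<one> x\<close>.\<close>
    case 0 show ?case using double[of "group_elem \<one> x"] by (simp add: geom_def)
  next
    case (Suc n)
    have "?L (Suc n) = \<alpha> * ?L n + \<alpha> * \<beta> ^ n * group_elem (g [^] n) x + \<beta> ^ Suc n * group_elem (g [^] Suc n) x"
      by (simp add: geom_Suc shift algebra_simps del: G.nat_pow_Suc)
    \<comment> \<open>The induction hypothesis contributes a second copy of the middle term, and the
      two copies cancel.\<close>
    also have "\<dots> = \<alpha> ^ Suc n * group_elem \<one> x + \<beta> ^ Suc n * group_elem (g [^] Suc n) x
        + (\<alpha> * \<beta> ^ n * group_elem (g [^] n) x + \<alpha> * \<beta> ^ n * group_elem (g [^] n) x)"
      unfolding Suc by (simp add: algebra_simps del: G.nat_pow_Suc)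
    finally show ?case by (simp only: double add_0_right)
  qed
qed

lemma group_elem_pow_shift:
  assumes "g \<in> carrier G" "x \<in> carrier G"
  shows "group_elem (g [^] (i::nat)) (inv g \<otimes> x) = group_elem (g [^] Suc i) x"
    and "group_elem (g [^] i) (x \<otimes> inv g) = group_elem (g [^] Suc i) x"
  using assms by (simp_all add: group_elem_shift G.nat_pow_Suc2[symmetric] del: G.nat_pow_Suc)

text \<open>The star is \<open>\<alpha> + \<beta> inv g\<close>, which commutes with
  \<open>\<alpha> + \<beta> g\<close>. The \<open>n\<close>-th power of \<open>inv g\<close> is also
  1, so the scaled \<open>geom\<close> of \<open>inv g\<close> is the inverse of the star.\<close>

lemma unitary_line_quotient:
  fixes \<alpha> \<beta> :: "'r::field"
  assumes two: "(1 + 1 :: 'r) = 0" and "\<alpha> + \<beta> = 1" and g: "g \<in> carrier G" and n: "g [^] n = \<one>"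
    and d: "\<alpha> ^ n + \<beta> ^ n \<noteq> 0"
  shows "line \<alpha> \<beta> g \<otimes>\<^bsub>A\<^esub> (\<lambda>x. geom \<alpha> \<beta> (inv g) n x / (\<alpha> ^ n + \<beta> ^ n)) \<in> unitary G"
proof (rule unitary_quotient)
  let ?d = "\<alpha> ^ n + \<beta> ^ n" let ?w = "\<lambda>x. geom \<alpha> \<beta> (inv g) n x / ?d"
  interpret A: ring "A :: ('g \<Rightarrow> 'r) ring" by (rule ring_group_algebra[OF G fin])
  have ig: "inv g \<in> carrier G" "inv g [^] n = \<one>" using g n by (auto simp: G.nat_pow_inv)
  show w: "?w \<in> carrier A" using geom_in[OF ig(1), of \<alpha> \<beta> n] by (simp add: group_algebra_def)
  show v: "line \<alpha> \<beta> g \<in> carrier A" using g by (rule line_in)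
  have q: "\<alpha> * (a / ?d) + \<beta> * (b / ?d) = (\<alpha> * a + \<beta> * b) / ?d" for a b
    by (simp add: add_divide_distrib)
  have f: "(\<alpha> ^ n * e + \<beta> ^ n * e) / ?d = e" for e using d by (simp flip: distrib_right)
  show "star G (line \<alpha> \<beta> g) \<otimes>\<^bsub>A\<^esub> ?w = \<one>\<^bsub>A\<^esub>"
    unfolding star_line[OF g]
  proof (rule group_algebra_eqI[OF A.m_closed[OF line_in[OF ig(1)] w] A.one_closed])
    fix x assume x: "x \<in> carrier G"
    show "(line \<alpha> \<beta> (inv g) \<otimes>\<^bsub>A\<^esub> ?w) x = \<one>\<^bsub>A\<^esub> x"
      unfolding line_mult_apply[OF ig(1) x] q geom_telescope[OF two group_elem_pow_shift(1)[OF ig(1) x]] ig(2) f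
      by (simp add: group_algebra_one)
  qed
  show "?w \<otimes>\<^bsub>A\<^esub> star G (line \<alpha> \<beta> g) = \<one>\<^bsub>A\<^esub>"
    unfolding star_line[OF g]
  proof (rule group_algebra_eqI[OF A.m_closed[OF w line_in[OF ig(1)]] A.one_closed])
    fix x assume x: "x \<in> carrier G"
    show "(?w \<otimes>\<^bsub>A\<^esub> line \<alpha> \<beta> (inv g)) x = \<one>\<^bsub>A\<^esub> x"
      unfolding mult_line_apply[OF ig(1) x] q geom_telescope[OF two group_elem_pow_shift(2)[OF ig(1) x]] ig(2) f
      by (simp add: group_algebra_one)
  qed
  show "line \<alpha> \<beta> g \<otimes>\<^bsub>A\<^esub> star G (line \<alpha> \<beta> g) = star G (line \<alpha> \<beta> g) \<otimes>\<^bsub>A\<^esub> line \<alpha> \<beta> g"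
    unfolding star_line[OF g]
  proof (rule group_algebra_eqI)
    fix x assume x: "x \<in> carrier G"
    have "line \<alpha> \<beta> (inv g) (inv g \<otimes> x) = line \<alpha> \<beta> (inv g) (x \<otimes> inv g)"
      using g x by (simp add: line_def group_elem_shift)
    then show "(line \<alpha> \<beta> g \<otimes>\<^bsub>A\<^esub> line \<alpha> \<beta> (inv g)) x = (line \<alpha> \<beta> (inv g) \<otimes>\<^bsub>A\<^esub> line \<alpha> \<beta> g) x"
      using g x by (simp add: line_mult_apply[of g] mult_line_apply[of g])
  qed (use v line_in[OF ig(1)] in auto)
  show "augmentation G (line \<alpha> \<beta> g) = 1" using assms by (simp add: augmentation_line)
qed

end

section \<open>The idempotent of an essential character\<close>

text \<open>Induction that removes one orbit \<open>{z, i z}\<close> at a time; it has two elements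
  as \<open>i\<close> has no fixed point.\<close>

lemma sum_in_of_involution_pairs:
  assumes "finite T" and inv: "\<And>z. z \<in> T \<Longrightarrow> i z \<in> T \<and> i (i z) = z \<and> i z \<noteq> z"
    and "0 \<in> J" "\<And>a b. a \<in> J \<Longrightarrow> b \<in> J \<Longrightarrow> a + b \<in> J" and pair: "\<And>z. z \<in> T \<Longrightarrow> c z + c (i z) \<in> J"
  shows "(\<Sum>z\<in>T. c z) \<in> (J :: 'a::comm_monoid_add set)"
  using assms(1) inv pair
proof (induction T rule: finite_psubset_induct)
  case (psubset T)
  show ?case
  proof (cases "T = {}")
    case False
    then obtain z where z: "z \<in> T" by blast
    let ?T = "T - {z, i z}"
    have "(\<Sum>z\<in>?T. c z) \<in> J"
    proof (rule psubset.IH)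
      fix w assume w: "w \<in> ?T"
      then have "i w \<noteq> z" "i w \<noteq> i z" using psubset.prems(1)[of w] psubset.prems(1)[of z] z by force+
      then show "i w \<in> ?T \<and> i (i w) = w \<and> i w \<noteq> w" using w psubset.prems(1)[of w] by blast
      show "c w + c (i w) \<in> J" using w psubset.prems(2) by blast
    qed (use z in blast)
    moreover have "(\<Sum>z\<in>T. c z) = c z + c (i z) + (\<Sum>z\<in>?T. c z)"
    proof -
      have "z \<noteq> i z" using psubset.prems(1)[OF z] by metis
      have "T = insert z (insert (i z) ?T)" using z psubset.prems(1)[OF z] by blast
      then have "(\<Sum>z\<in>T. c z) = (\<Sum>z\<in>insert z (insert (i z) ?T). c z)" by simp
      also have "\<dots> = c z + c (i z) + (\<Sum>z\<in>?T. c z)"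
        using \<open>z \<noteq> i z\<close> psubset.hyps by (simp add: add.assoc)
      finally show ?thesis .
    qed
    ultimately show ?thesis using psubset.prems(2)[OF z] assms(4) by simp
  qed (use assms(3) in simp)
qed

text \<open>For \<open>z \<notin> H\<close> let \<open>c z = (\<Sum>y\<in>H. \<xi> y * \<xi> (inv z \<otimes> y))\<close>. The product of the two partial
  augmentations of \<open>\<xi>\<close> is the sum of all \<open>c z\<close>, whereas the coefficient of \<open>\<xi> \<xi>\<^sup>*\<close> at \<open>z\<close> is
  \<open>c z + c (inv z)\<close>; since \<open>z \<noteq> inv z\<close>, the former is a sum of the latter.\<close>

lemma partial_augmentations_orthogonal:
  fixes G (structure) and \<xi> :: "'g \<Rightarrow> 'r::comm_ring_1"
  assumes G: "group G" "finite (carrier G)" and H: "subgroup H G"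
    and T: "T = carrier G - H" "\<And>x y. x \<in> T \<Longrightarrow> y \<in> T \<Longrightarrow> x \<otimes> y \<in> H" "\<And>x. x \<in> T \<Longrightarrow> x \<otimes> x \<noteq> \<one>"
    and J: "0 \<in> J" "\<And>a b. a \<in> J \<Longrightarrow> b \<in> J \<Longrightarrow> a + b \<in> J"
    and rel: "\<And>z. z \<in> T \<Longrightarrow> (\<xi> \<otimes>\<^bsub>group_algebra G\<^esub> star G \<xi>) z \<in> J"
  shows "(\<Sum>x\<in>H. \<xi> x) * (\<Sum>x\<in>T. \<xi> x) \<in> J"
proof -
  interpret group G by fact
  interpret H: subgroup H G by fact
  define c where "c = (\<lambda>z. \<Sum>y\<in>H. \<xi> y * \<xi> (inv z \<otimes> y))"
  have Tc: "x \<in> carrier G" "x \<notin> H" if "x \<in> T" for x using that T by auto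
  have invT: "inv x \<in> T" if x: "x \<in> T" for x
    using Tc[OF x] H.m_inv_closed[of "inv x"] by (auto simp: T(1))
  have HT: "x \<otimes> y \<in> T" "y \<otimes> x \<in> T" if "x \<in> T" "y \<in> H" for x y
  proof -
    note xy = Tc[OF that(1)] H.mem_carrier[OF that(2)]
    have "x \<otimes> y \<notin> H"
    proof
      assume "x \<otimes> y \<in> H"
      then have "(x \<otimes> y) \<otimes> inv y \<in> H" using that by blast
      then show False using xy by (simp add: m_assoc)
    qed
    moreover have "y \<otimes> x \<notin> H"
    proof
      assume "y \<otimes> x \<in> H"
      then have "inv y \<otimes> (y \<otimes> x) \<in> H" using that by blast
      then show False using xy by (simp add: m_assoc[symmetric])
    qed
    ultimately show "x \<otimes> y \<in> T" "y \<otimes> x \<in> T" using xy by (auto simp: T(1))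
  qed
  have fin: "finite H" "finite T"
    using G(2) H.subset finite_subset by (auto simp: T(1))
  have coeff: "(\<xi> \<otimes>\<^bsub>group_algebra G\<^esub> star G \<xi>) z = c z + c (inv z)" if z: "z \<in> T" for z
  proof -
    have zc: "z \<in> carrier G" using Tc z by blast
    have "(\<xi> \<otimes>\<^bsub>group_algebra G\<^esub> star G \<xi>) z = (\<Sum>y\<in>carrier G. \<xi> y * \<xi> (inv z \<otimes> y))"
      using zc by (auto simp: group_algebra_mult_apply[OF G] star_def inv_mult_group intro!: sum.cong)
    also have "carrier G = H \<union> T" using H.subset by (auto simp: T(1))
    also have "(\<Sum>y\<in>H \<union> T. \<xi> y * \<xi> (inv z \<otimes> y)) = c z + (\<Sum>y\<in>T. \<xi> y * \<xi> (inv z \<otimes> y))"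
      using fin by (subst sum.union_disjoint) (auto simp: T(1) c_def)
    \<comment> \<open>Translation by \<open>inv z\<close> maps \<open>T\<close> bijectively onto
      \<open>H\<close> and exchanges the roles of the two factors.\<close>
    also have "(\<Sum>y\<in>T. \<xi> y * \<xi> (inv z \<otimes> y)) = c (inv z)"
      unfolding c_def
      by (rule sum.reindex_bij_witness[where i = "\<lambda>y. z \<otimes> y" and j = "\<lambda>y. inv z \<otimes> y"])
        (use z zc T(2) invT HT in \<open>auto simp: m_assoc[symmetric] mult.commute dest: Tc\<close>)
    finally show ?thesis .
  qed
  have "(\<Sum>z\<in>T. c z) \<in> J"
  proof (rule sum_in_of_involution_pairs[OF fin(2) _ J, where i = "\<lambda>z. inv z"])
    fix z assume z: "z \<in> T"
    have "inv z \<noteq> z" using T(3)[OF z] r_inv[OF Tc(1)[OF z]] by metis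
    then show "inv z \<in> T \<and> inv (inv z) = z \<and> inv z \<noteq> z" using z invT Tc by auto
    show "c z + c (inv z) \<in> J" using rel[OF z] coeff[OF z] by simp
  qed auto
  also have "(\<Sum>z\<in>T. c z) = (\<Sum>y\<in>H. \<Sum>z\<in>T. \<xi> y * \<xi> (inv z \<otimes> y))"
    unfolding c_def by (rule sum.swap)
  \<comment> \<open>For fixed \<open>y \<in> H\<close> the substitution
    \<open>x = inv z \<otimes> y\<close> permutes \<open>T\<close>.\<close>
  also have "\<dots> = (\<Sum>y\<in>H. \<Sum>x\<in>T. \<xi> y * \<xi> x)"
  proof (rule sum.cong[OF refl])
    fix y assume y: "y \<in> H"
    have canc: "y \<otimes> (inv y \<otimes> a) = a" if "a \<in> carrier G" for a
      using that H.mem_carrier[OF y] by (simp flip: m_assoc)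
    show "(\<Sum>z\<in>T. \<xi> y * \<xi> (inv z \<otimes> y)) = (\<Sum>x\<in>T. \<xi> y * \<xi> x)"
      by (rule sum.reindex_bij_witness[where i = "\<lambda>x. y \<otimes> inv x" and j = "\<lambda>z. inv z \<otimes> y"])
        (use y invT HT canc H.mem_carrier[OF y] Tc(1) in \<open>auto simp: inv_mult_group m_assoc\<close>)
  qed
  also have "\<dots> = (\<Sum>x\<in>H. \<xi> x) * (\<Sum>x\<in>T. \<xi> x)"
    by (simp add: sum_product)
  finally show ?thesis .
qed

text \<open>Modulo \<open>unitary_ideal G\<close> the partial augmentations \<open>E\<close> over
  the kernel and \<open>F\<close> over its complement satisfy \<open>E F = 0\<close> and
  \<open>E + F = 1\<close>. The value of \<open>E\<close> is 1 at the identity and 0 at group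
  elements outside of the kernel, so such elements lie in other components.\<close>

lemma id_component_subset_kernel:
  fixes G (structure)
  assumes G: "group G" "finite (carrier G)" and C: "group C" "order C = 2"
    and \<epsilon>: "\<epsilon> \<in> essential_characters G C" and g: "g \<in> carrier G"
    and conn: "(group_elem g :: 'g \<Rightarrow> 'k::field) \<in> unitary_id_component_points G"
  shows "\<epsilon> g = \<one>\<^bsub>C\<^esub>"
proof (rule ccontr)
  assume ne: "\<epsilon> g \<noteq> \<one>\<^bsub>C\<^esub>"
  interpret G: group G by fact
  interpret C: group C by fact
  interpret \<epsilon>: group_hom G C \<epsilon>
    by (rule group_hom.intro) (use G C \<epsilon> in \<open>auto simp: group_hom_axioms_def essential_characters_def\<close>)
  let ?P = "mpoly_ring (carrier G) :: (('g \<Rightarrow>\<^sub>0 nat) \<Rightarrow>\<^sub>0 'k) ring"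
  let ?A = "unitary_coord_ring G :: (('g \<Rightarrow>\<^sub>0 nat) \<Rightarrow>\<^sub>0 'k) set ring"
  let ?I = "unitary_ideal G :: (('g \<Rightarrow>\<^sub>0 nat) \<Rightarrow>\<^sub>0 'k) set"
  let ?\<xi> = "generic_elem G :: 'g \<Rightarrow> ('g \<Rightarrow>\<^sub>0 nat) \<Rightarrow>\<^sub>0 'k"
  obtain c where c: "c \<noteq> \<one>\<^bsub>C\<^esub>" "carrier C = {\<one>\<^bsub>C\<^esub>, c}" "c \<otimes>\<^bsub>C\<^esub> c = \<one>\<^bsub>C\<^esub>"
    using C.order_two_ex[OF C(2)] .
  define H where "H = kernel G C \<epsilon>"
  define T where "T = carrier G - H"
  have H: "subgroup H G" unfolding H_def by (rule \<epsilon>.subgroup_kernel)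
  have T: "x \<in> carrier G" "\<epsilon> x = c" "\<epsilon> x \<noteq> \<one>\<^bsub>C\<^esub>" if "x \<in> T" for x
    using that c(2) \<epsilon>.hom_closed[of x] by (auto simp: T_def H_def kernel_def)
  have TT: "x \<otimes> y \<in> H" if "x \<in> T" "y \<in> T" for x y
    using T[OF that(1)] T[OF that(2)] c(3) by (simp add: H_def kernel_def)
  \<comment> \<open>Here essentiality enters: \<open>\<epsilon>\<close> is trivial on elements of
    square 1.\<close>
  have T2: "x \<otimes> x \<noteq> \<one>" if "x \<in> T" for x
    using T[OF that] \<epsilon> by (auto simp: essential_characters_def)
  interpret P: cring ?P by (rule cring_poly_ring)
  interpret I: ideal ?I ?P by (rule ideal_unitary_ideal)
  interpret h: ring_hom_ring ?P ?A "coord_class G"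
    using I.rcos_ring_hom_ring unfolding unitary_coord_ring_def coord_class_def[abs_def] .
  have rel: "unitary_relations G \<subseteq> ?I"
    unfolding unitary_ideal_def by (rule P.genideal_self[OF unitary_relations_in])
  define E where "E = (\<Sum>x\<in>H. ?\<xi> x)"
  define F where "F = (\<Sum>x\<in>T. ?\<xi> x)"
  have EF_in: "E \<in> carrier ?P" "F \<in> carrier ?P"
    unfolding E_def F_def by (auto intro!: poly_ring_sum generic_in)
  have "E * F \<in> ?I"
    unfolding E_def F_def
  proof (rule partial_augmentations_orthogonal[OF G H T_def TT T2])
    show "0 \<in> ?I" using I.zero_closed by simp
    show "a + b \<in> ?I" if "a \<in> ?I" "b \<in> ?I" for a b using I.a_closed[OF that] by simp
    fix z assume z: "z \<in> T"
    then have "(?\<xi> \<otimes>\<^bsub>group_algebra G\<^esub> star G ?\<xi>) z - group_elem \<one> z \<in> ?I"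
      using rel T(1)[OF z] unfolding unitary_relations_def Let_def by blast
    \<comment> \<open>Away from the identity the unitarity relation has no constant term.\<close>
    moreover have "z \<noteq> \<one>" using T2[OF z] by auto
    ultimately show "(?\<xi> \<otimes>\<^bsub>group_algebra G\<^esub> star G ?\<xi>) z \<in> ?I" by (simp add: group_elem_def)
  qed
  then have "coord_class G (E * F) = coord_class G 0"
    using P.quotient_eq_iff_same_a_r_cos[OF ideal_unitary_ideal poly_ring_closed(2)[OF EF_in] poly_ring_0_1(1)]
    by (simp add: coord_class_def poly_ring_diff poly_ring_closed EF_in poly_ring_0_1)
  then have ef: "coord_class G E \<otimes>\<^bsub>?A\<^esub> coord_class G F = \<zero>\<^bsub>?A\<^esub>"
    using h.hom_mult[OF EF_in] h.hom_zero by simp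
  have "E + F = augmentation G ?\<xi>"
  proof -
    have "(\<Sum>x\<in>carrier G. ?\<xi> x) = (\<Sum>x\<in>T. ?\<xi> x) + (\<Sum>x\<in>H. ?\<xi> x)"
      unfolding T_def by (rule sum.subset_diff[OF subgroup.subset[OF H] G(2)])
    then show ?thesis unfolding augmentation_def E_def F_def by (simp add: add.commute)
  qed
  then have "E + F - 1 \<in> ?I" using rel unfolding unitary_relations_def Let_def by auto
  then have "coord_class G (E + F) = coord_class G 1"
    using P.quotient_eq_iff_same_a_r_cos[OF ideal_unitary_ideal poly_ring_closed(1)[OF EF_in] poly_ring_0_1(2)]
    by (simp add: coord_class_def poly_ring_diff poly_ring_closed EF_in poly_ring_0_1)
  then have e1: "coord_class G E \<oplus>\<^bsub>?A\<^esub> coord_class G F = \<one>\<^bsub>?A\<^esub>"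
    using h.hom_add[OF EF_in] h.hom_one by simp
  have ev: "poly_eval (\<lambda>a. a) u E = (\<Sum>x\<in>H. u x)" for u :: "'g \<Rightarrow> 'k"
    unfolding E_def using subgroup.subset[OF H]
    by (subst poly_eval_sum) (auto simp: generic_elem_def poly_eval_var intro!: sum.cong)
  have finH: "finite H" using G(2) subgroup.subset[OF H] finite_subset by blast
  have mem: "coord_class G E \<in> unitary_point G (group_elem a :: 'g \<Rightarrow> 'k) \<longleftrightarrow> a \<notin> H"
    if a: "a \<in> carrier G" for a
  proof -
    have "(\<Sum>x\<in>H. group_elem a x) = (if a \<in> H then 1 else (0::'k))"
      using finH by (simp add: group_elem_def)
    then show ?thesis
      by (simp add: mem_unitary_point[OF G group_elem_unitary[OF G a] EF_in(1)] ev)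
  qed
  have "coord_class G E \<notin> unitary_point G (group_elem g :: 'g \<Rightarrow> 'k)"
  proof (rule idempotent_separates_zariski[OF cring_unitary_coord_ring _ _ e1 ef])
    show "connected_component_of (zariski ?A) (unitary_point G (group_elem \<one>)) (unitary_point G (group_elem g :: 'g \<Rightarrow> 'k))"
      using conn by (simp add: unitary_id_component_points_def unitary_id_component_def group_algebra_one[OF G])
    show "coord_class G E \<notin> unitary_point G (group_elem \<one> :: 'g \<Rightarrow> 'k)"
      using mem[of \<one>] subgroup.one_closed[OF H] by simp
  qed (use EF_in h.hom_closed in auto)
  then show False using mem[OF g] ne by (simp add: H_def kernel_def)
qed

section \<open>Rational curves through elements of the group\<close>

text \<open>The start \<open>t = 0\<close> of the curve: only the term \<open>i = 0\<close>
  survives, with \<open>0 ^ 0 = 1\<close>. It is present because there are \<open>Suc n\<close>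
  terms.\<close>

lemma geom_1_0:
  assumes "group G" "finite (carrier G)"
  shows "geom G 1 0 g (Suc n) x = group_elem \<one>\<^bsub>G\<^esub> x"
proof (induction n)
  case 0 show ?case by (simp add: geom_def[OF assms])
next
  case (Suc n) then show ?case by (simp add: geom_Suc[OF assms, of _ _ _ "Suc n"])
qed

text \<open>The end \<open>t = 1\<close> of the curve: only the last term survives, with exponent
  one less than the number of terms.\<close>

lemma geom_0_1:
  assumes "group G" "finite (carrier G)"
  shows "geom G 0 1 g (Suc n) x = group_elem (g [^]\<^bsub>G\<^esub> n) x"
  by (simp add: geom_Suc[OF assms])

lemma to_fract_group_elem: "to_fract (group_elem g x) = group_elem g x"
  by (simp add: group_elem_def)

lemma to_fract_geom:
  "group G \<Longrightarrow> finite (carrier G) \<Longrightarrow> to_fract (geom G a b g n x) = geom G (to_fract a) (to_fract b) g n x"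
  by (simp add: geom_def to_fract_power to_fract_group_elem)

lemma poly_group_elem: "poly (group_elem g x) c = group_elem g x"
  by (simp add: group_elem_def)

lemma poly_geom:
  "group G \<Longrightarrow> finite (carrier G) \<Longrightarrow> poly (geom G a b g n x) c = geom G (poly a c) (poly b c) g n x"
  by (simp add: geom_def poly_sum poly_group_elem)

definition unitary_connected :: "('g, 'm) monoid_scheme \<Rightarrow> ('g \<Rightarrow> 'k::field) \<Rightarrow> ('g \<Rightarrow> 'k) \<Rightarrow> bool" where
  "unitary_connected G u v \<longleftrightarrow>
     connected_component_of (zariski (unitary_coord_ring G)) (unitary_point G u) (unitary_point G v)"

context
  fixes G :: "('g, 'm) monoid_scheme" (structure)
  assumes G: "group G" and fin: "finite (carrier G)" and two: "(1 + 1 :: 'k::field) = 0"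
begin

interpretation G: group G by (rule G)

lemma two_fract: "(1 + 1 :: 'k poly fract) = 0"
proof -
  have "(1 + 1 :: 'k poly) = 0" using two by (simp add: one_pCons)
  then show ?thesis by (metis to_fract_0 to_fract_1 to_fract_add)
qed

lemma sum_params: "to_fract [:1, - 1:] + to_fract [:0, 1 :: 'k:] = 1"
  by (simp flip: to_fract_add) (metis one_pCons to_fract_1)

text \<open>The curve \<open>h ((1 - t) + t g)\<close> has polynomial coordinates, so its
  denominator is 1.\<close>

lemma unitary_connected_involution:
  assumes h: "h \<in> carrier G" and g: "g \<in> carrier G" "g \<otimes> g = \<one>"
  shows "unitary_connected G (group_elem h :: 'g \<Rightarrow> 'k) (group_elem (h \<otimes> g))"
proof -
  define \<alpha> :: "'k poly" where "\<alpha> = [:1, - 1:]"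
  define \<beta> :: "'k poly" where "\<beta> = [:0, 1:]"
  note params = sum_params[folded \<alpha>_def \<beta>_def]
  let ?u = "group_elem h \<otimes>\<^bsub>group_algebra G\<^esub> line G (to_fract \<alpha>) (to_fract \<beta>) g"
  \<comment> \<open>Translation by \<open>h\<close> moves the coefficient at
    \<open>inv h \<otimes> x\<close> to \<open>x\<close>; outside of the group the coefficient must
    be 0.\<close>
  define N where "N = (\<lambda>x. if x \<in> carrier G then line G \<alpha> \<beta> g (inv h \<otimes> x) else 0)"
  have u: "?u \<in> unitary G"
    by (intro unitary_mult[OF G fin] group_elem_unitary[OF G fin] unitary_line[OF G fin] two_fract params h g)
  show ?thesis
    unfolding unitary_connected_def
  proof (rule rational_curve_connected[OF G fin u, where d = 1 and b = 0 and c = 1 and N = N])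
    fix x
    show "?u x * to_fract 1 = to_fract (N x)"
      using unitary_in[OF G fin u] h
      by (auto simp: N_def group_elem_mult_apply[OF G fin] line_def[OF G fin] to_fract_group_elem)
         (simp add: group_algebra_def)
  next
    show "group_elem h = (\<lambda>x. poly (N x) 0)" "group_elem (h \<otimes> g) = (\<lambda>x. poly (N x) 1)"
      using h g by (auto simp: fun_eq_iff N_def line_def[OF G fin] \<alpha>_def \<beta>_def poly_group_elem
          group_elem_shift[OF G fin] group_elem_outside[OF G fin])
  qed (use h g in \<open>auto intro: group_elem_unitary[OF G fin]\<close>)
qed

text \<open>With \<open>v = (1 - t) + t g\<close> the curve \<open>h (v / star v)\<close> runs from
  \<open>h\<close> to \<open>h g / inv g = h g g\<close>. If \<open>n\<close> is the order of
  \<open>G\<close>, the denominator \<open>(1 - t) ^ n + t ^ n\<close> is 1 at both ends.\<close>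

lemma unitary_connected_square:
  assumes h: "h \<in> carrier G" and g: "g \<in> carrier G"
  shows "unitary_connected G (group_elem h :: 'g \<Rightarrow> 'k) (group_elem (h \<otimes> (g \<otimes> g)))"
proof -
  define \<alpha> :: "'k poly" where "\<alpha> = [:1, - 1:]"
  define \<beta> :: "'k poly" where "\<beta> = [:0, 1:]"
  note params = sum_params[folded \<alpha>_def \<beta>_def]
  \<comment> \<open>The form \<open>Suc m\<close> records that the order is positive, as the end
    values of \<open>d\<close> require, and names the last exponent of \<open>geom\<close>.\<close>
  obtain m where n: "order G = Suc m"
    using fin G.order_gt_0_iff_finite gr0_implies_Suc by blast
  let ?n = "Suc m"
  have gn: "g [^] ?n = \<one>" using G.pow_order_eq_1[OF g] by (simp only: n)
  \<comment> \<open>This is the group element in the last term of \<open>geom\<close>, the only one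
    left at \<open>t = 1\<close>.\<close>
  have gm: "inv g [^] m = g"
  proof -
    have "inv g [^] m = inv (g [^] m)" using g by (simp add: G.nat_pow_inv)
    also have "\<dots> = g" using g gn by (intro G.inv_equality) (auto simp flip: G.nat_pow_Suc2)
    finally show ?thesis .
  qed
  define d where "d = \<alpha> ^ ?n + \<beta> ^ ?n"
  have pd: "poly d 0 = 1" "poly d 1 = 1" by (simp_all add: d_def \<alpha>_def \<beta>_def)
  then have "d \<noteq> 0" by auto
  then have d0: "to_fract d \<noteq> 0" by simp
  have d': "to_fract d = to_fract \<alpha> ^ ?n + to_fract \<beta> ^ ?n" by (simp only: d_def to_fract_add to_fract_power)
  let ?w = "\<lambda>x. geom G (to_fract \<alpha>) (to_fract \<beta>) (inv g) ?n x / (to_fract \<alpha> ^ ?n + to_fract \<beta> ^ ?n)"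
  let ?u = "group_elem h \<otimes>\<^bsub>group_algebra G\<^esub> (line G (to_fract \<alpha>) (to_fract \<beta>) g \<otimes>\<^bsub>group_algebra G\<^esub> ?w)"
  \<comment> \<open>Multiplication by \<open>d\<close> clears the denominator of \<open>?w\<close>
    and leaves \<open>geom\<close> over \<open>k[t]\<close>.\<close>
  define N where "N = (\<lambda>x. if x \<in> carrier G
    then \<alpha> * geom G \<alpha> \<beta> (inv g) ?n (inv h \<otimes> x) + \<beta> * geom G \<alpha> \<beta> (inv g) ?n (inv g \<otimes> (inv h \<otimes> x)) else 0)"
  have u: "?u \<in> unitary G"
    by (intro unitary_mult[OF G fin] group_elem_unitary[OF G fin] h
        unitary_line_quotient[OF G fin two_fract params g gn] d0[unfolded d'])
  show ?thesis
    unfolding unitary_connected_def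
  proof (rule rational_curve_connected[OF G fin u, where d = d and b = 0 and c = 1 and N = N])
    fix x
    show "?u x * to_fract d = to_fract (N x)"
    proof (cases "x \<in> carrier G")
      case True
      then have y: "inv h \<otimes> x \<in> carrier G" using h by simp
      have e: "?w z * to_fract d = to_fract (geom G \<alpha> \<beta> (inv g) ?n z)" for z
        using d0 unfolding d' to_fract_geom[OF G fin] by simp
      have "?u x * to_fract d = to_fract \<alpha> * (?w (inv h \<otimes> x) * to_fract d)
          + to_fract \<beta> * (?w (inv g \<otimes> (inv h \<otimes> x)) * to_fract d)"
        unfolding group_elem_mult_apply[OF G fin h True] line_mult_apply[OF G fin g y]
        by (simp only: distrib_right mult.assoc)
      then show ?thesis using True unfolding e by (simp add: N_def)
    next
      case False
      then show ?thesis using unitary_in[OF G fin u] by (simp add: N_def) (simp add: group_algebra_def)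
    qed
  next
    show "group_elem h = (\<lambda>x. poly (N x) 0)"
      using h by (auto simp: fun_eq_iff N_def \<alpha>_def \<beta>_def poly_geom[OF G fin] geom_1_0[OF G fin]
          group_elem_shift[OF G fin] group_elem_outside[OF G fin])
    show "group_elem (h \<otimes> (g \<otimes> g)) = (\<lambda>x. poly (N x) 1)"
      using h g by (auto simp: fun_eq_iff N_def \<alpha>_def \<beta>_def poly_geom[OF G fin] geom_0_1[OF G fin] gm
          group_elem_shift[OF G fin] group_elem_outside[OF G fin])
  qed (use h g pd in \<open>auto intro: group_elem_unitary[OF G fin]\<close>)
qed

text \<open>A word in the generators is followed letter by letter, from \<open>h\<close> to
  \<open>h a\<close> to \<open>h a b\<close>; therefore the induction keeps \<open>h\<close>
  arbitrary.\<close>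

lemma unitary_connected_generate:
  assumes "a \<in> generate G ({g \<in> carrier G. group.ord G g = 2} \<union> {g \<otimes> g | g. g \<in> carrier G})" (is "a \<in> generate G ?S")
    and "h \<in> carrier G"
  shows "unitary_connected G (group_elem h :: 'g \<Rightarrow> 'k) (group_elem (h \<otimes> a))"
proof -
  have step: "unitary_connected G (group_elem h :: 'g \<Rightarrow> 'k) (group_elem (h \<otimes> a))"
    if S: "a \<in> ?S" and hc: "h \<in> carrier G" for a h
  proof -
    consider "a \<in> carrier G" "G.ord a = 2" | g where "g \<in> carrier G" "a = g \<otimes> g" using S by auto
    then show ?thesis
    proof cases
      case 1
      have "a \<otimes> a = \<one>" using G.pow_ord_eq_1[OF 1(1)] 1 by (simp add: numeral_2_eq_2)
      then show ?thesis by (rule unitary_connected_involution[OF hc 1(1)])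
    next
      case 2
      then show ?thesis using unitary_connected_square[OF hc 2(1)] by simp
    qed
  qed
  show ?thesis
    using assms
  proof (induction arbitrary: h rule: generate.induct)
    case one
    \<comment> \<open>The identity has square 1 too; its constant curve gives reflexivity.\<close>
    then show ?case using unitary_connected_involution[of h \<one>] by simp
  next
    case (incl a)
    then show ?case by (rule step)
  next
    case (inv a)
    then have a: "a \<in> carrier G" by auto
    \<comment> \<open>The step by \<open>a\<close> from \<open>h \<otimes> inv a\<close> ends at
      \<open>h\<close>; symmetry reverses it.\<close>
    have "unitary_connected G (group_elem (h \<otimes> inv a) :: 'g \<Rightarrow> 'k) (group_elem (h \<otimes> inv a \<otimes> a))"
      using inv a by (intro step) auto
    moreover have "h \<otimes> inv a \<otimes> a = h" using a inv.prems by (simp add: G.m_assoc)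
    ultimately show ?case unfolding unitary_connected_def by (simp add: connected_component_of_sym)
  next
    case (eng a b)
    have "?S \<subseteq> carrier G" by auto
    then have ab: "a \<in> carrier G" "b \<in> carrier G"
      using eng.hyps G.generate_in_carrier by blast+
    have "unitary_connected G (group_elem (h \<otimes> a) :: 'g \<Rightarrow> 'k) (group_elem (h \<otimes> a \<otimes> b))"
      using eng.IH(2) eng.prems ab by simp
    then show ?case
      using eng.IH(1)[OF eng.prems] unfolding unitary_connected_def G.m_assoc[OF eng.prems ab]
      by (rule connected_component_of_trans[rotated])
  qed
qed

end

theorem mainTheorem4:
  fixes G :: "('g, 'm) monoid_scheme" and C :: "('c, 'n) monoid_scheme"
  assumes "group G" and "finite (carrier G)"
    and "group C" and "order C = 2"
  shows "essential_kernel G C =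
           generate G ({g \<in> carrier G. group.ord G g = 2} \<union> {g \<otimes>\<^bsub>G\<^esub> g | g. g \<in> carrier G})
         \<and> (CHAR('k::field) = 2 \<longrightarrow>
           essential_kernel G C =
             {g \<in> carrier G. (group_elem g :: 'g \<Rightarrow> 'k) \<in> unitary_id_component_points G})"
proof (intro conjI impI)
  interpret G: group G by fact
  let ?S = "{g \<in> carrier G. group.ord G g = 2} \<union> {g \<otimes>\<^bsub>G\<^esub> g | g. g \<in> carrier G}"
  show gen: "essential_kernel G C = generate G ?S"
    by (rule essential_kernel_eq_generate[OF assms])
  assume char: "CHAR('k) = 2"
  have two: "(1 + 1 :: 'k) = 0" using of_nat_CHAR[where ?'a = 'k] by (simp add: char)
  show "essential_kernel G C =
      {g \<in> carrier G. (group_elem g :: 'g \<Rightarrow> 'k) \<in> unitary_id_component_points G}" (is "_ = ?U")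
  proof
    show "essential_kernel G C \<subseteq> ?U"
    proof
      fix g assume g: "g \<in> essential_kernel G C"
      have "?S \<subseteq> carrier G" by auto
      then have gc: "g \<in> carrier G" using g G.generate_in_carrier unfolding gen by blast
      have "unitary_connected G (group_elem \<one>\<^bsub>G\<^esub> :: 'g \<Rightarrow> 'k) (group_elem (\<one>\<^bsub>G\<^esub> \<otimes>\<^bsub>G\<^esub> g))"
        using g unfolding gen
        by (intro unitary_connected_generate[OF assms(1,2) two]) auto
      then show "g \<in> ?U" using gc group_elem_unitary[OF assms(1,2) gc, where ?'c = 'k]
        by (simp add: unitary_connected_def unitary_id_component_points_def unitary_id_component_def
            group_algebra_one[OF assms(1,2)])
    qed
    show "?U \<subseteq> essential_kernel G C"
      using id_component_subset_kernel[OF assms] by (auto simp: essential_kernel_def kernel_def)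
  qed
qed

end
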